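(* Let $(X,\mathcal A,\mu)$ be an isometric target space of the projective system $\{(X_n,\mathcal A_n,\mu_n)\}_{n\in\mathbb N}$ (with mappings $\delta_m^n$, $\delta^n$). For $n\in\mathbb N$ let $A_n$ be an $\mathcal A_n$-measurable transformation of $X_n$, and let $A$ be an $\mathcal A$-measurable transformation of $X$, such that for all $k\in\mathbb N$ and all $\sigma\in\mathcal A_k$ $$\lim_{n\to\infty}\mu\Big((\delta_n^k\circ A_n\circ\delta^n)^{-1}(\sigma)\,\triangle\,(\delta^k\circ A)^{-1}(\sigma)\Big)=0 .$$ (i) Then $(X,\mathcal A,\mu\circ A^{-1})$ is a target space of $\{(X_n,\mathcal A_n,\mu_n\circ A_n^{-1})\}_{n\in\mathbb N}$ (with respect to the same mappings $\delta_m^n$, $\delta^n$). (ii) Suppose in addition that $\mu_n\circ A_n^{-1}\ll\mu_n$ for all $n\in\mathbb N$ and that there exists a sequence $\{Y_n\}_{n\in\mathbb N}$ of cylinder sets such that $Y_n\nearrow X$ as $n\to\infty$, and for every $k\in\mathbb N$: $\{\chi_{Y_k}\Delta_n\mathsf h^{A_n}\colon n\in\mathbb N\}\subseteq L^1(\mu)$ and $\mathscr M\big(\{\chi_{Y_k}\Delta_n\mathsf h^{A_n}\colon n\in\mathbb N\}\big)\neq\varnothing$. Then $C_A$ is densely defined and closed in $L^2(\mu)$ and $$C_A=\overline{(\mathtt{lim}\,C_{A_n})|_{\tilde{\mathscr F}}},\qquad \text{where } \tilde{\mathscr F}=\{\chi_{Y_k}f\colon f\in\mathscr F,\ k\in\mathbb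 N\}.$$
   Context: Notation: $\sigma_1\triangle\sigma_2$ is the symmetric difference; $Y_n\nearrow X$ means $Y_n\subseteq Y_{n+1}$ for all $n$ and $\bigcup_n Y_n=X$; $\overline T$ is the closure of an operator $T$; all operators are linear and possibly unbounded; $L^p$-spaces are complex. Projective systems. A sequence $\{(X_n,\mathcal A_n,\mu_n)\}_{n\in\mathbb N}$ of measure spaces is a projective system if there are surjective mappings $\delta_m^n\colon X_m\to X_n$ ($n\le m$) such that each $\delta_m^n$ is $(\mathcal A_m,\mathcal A_n)$-measurable, $\delta_k^n=\delta_m^n\circ\delta_k^m$ for $n\le m\le k$, and $\delta_n^n$ is the identity. A measure space $(X,\mathcal A,\mu)$ is a target space of it if there are surjective mappings $\delta^n\colon X\to X_n$ such that each $\delta^n$ is $(\mathcal A,\mathcal A_n)$-measurable, $\delta^n=\delta_m^n\circ\delta^m$ for $n\le m$, $\mathcal A$ is the $\sigma$-algebra generated by $\{(\delta^n)^{-1}(\sigma)\colon \sigma\in\mathcal A_n,\ n\in\mathbb N\}$, and $\mu((\delta^n)^{-1}(\sigma))=\lim_{m\to\infty}\mu_m((\delta_m^n)^{-1}(\sigma))$ for all $\sigma\in\mathcal A_n$, $n\in\mathbb N$. Sets $(\delta^k)^{-1}(\sigma)$ with $\sigma\in\mathcal A_k$, $k\in\mathbb N$, are called cylinder sets. The target space is isometric if, for every $k\in\mathbb N$, $\mu_k$ is $\sigma$-finite, $\mu\circ(\delta^k)^{-1}\ll\mu_k$ with $\frac{d\mu\circ(\delta^k)^{-1}}{d\mu_k}\in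 L^\infty(\mu_k)$, and the operator $\Delta_k\colon L^2(\mu_k)\ni f\mapsto f\circ\delta^k\in L^2(\mu)$ is an isometry. Then the operators $\Delta_k^l\colon L^2(\mu_k)\ni f\mapsto f\circ\delta_l^k\in L^2(\mu_l)$ ($k\le l$) are also isometries. The notation $\Delta_n g=g\circ\delta^n$ is used for any measurable function $g$ on $X_n$. $\mathscr F$ is the linear span in $L^2(\mu)$ of all characteristic functions $\chi_\sigma$ with $\sigma\in\mathcal A$, $\mu(\sigma)<\infty$, and $\chi_\sigma\in\bigcup_{n}\Delta_nL^2(\mu_n)$. Composition operators. For a $\sigma$-finite measure space $(Y,\mathcal B,\nu)$ and a $\mathcal B$-measurable $T\colon Y\to Y$, let $\nu\circ T^{-1}(\sigma)=\nu(T^{-1}(\sigma))$. $T$ is nonsingular if $\nu\circ T^{-1}\ll\nu$; then $\mathsf h^T=\frac{d\nu\circ T^{-1}}{d\nu}$ and $C_T$ is the (well-defined) operator in $L^2(\nu)$ with domain $\{f\in L^2(\nu)\colon f\circ T\in L^2(\nu)\}$ and $C_Tf=f\circ T$. Assertions about $C_A$ include the assertion that $A$ is nonsingular, so that $C_A$ is well defined. Inductive limit of operators. For operators $C_n$ in $L^2(\mu_n)$, let $D_\infty=\bigcup_{k}\{\Delta_kf\colon f\in L^2(\mu_k),\ \exists M\ge k\ \forall m\ge M\colon \Delta_k^mf\in \mathrm D(C_m)\}$. The operator $\mathtt{lim}\,C_n$ in $L^2(\mu)$ has domain $\{\Delta_kf\in D_\infty\colon \lim_{m\to\infty}\Delta_mC_m\Delta_k^mf\text{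 exists in }L^2(\mu)\}$ and acts by $(\mathtt{lim}\,C_n)\Delta_kf=\lim_{m\to\infty}\Delta_mC_m\Delta_k^mf$. The family $\mathscr M$. For functions $f_n\in L^1(\nu_n)$, $n\in\mathbb N$, $\mathscr M(\{f_n\colon n\in\mathbb N\})$ is the set of all monotonically increasing convex functions $G\colon[0,\infty)\to[0,\infty)$ with $\lim_{t\to\infty}G(t)/t=\infty$ and $\sup_n\int G(|f_n|)\,d\nu_n<\infty$ (here all $\nu_n=\mu$). *)

theory Defs
  imports "HOL-Analysis.Analysis"
begin

text \<open>
  Elements of \<open>L\<^sup>2\<close> are represented by square-integrable complex functions that are only
  ever compared almost everywhere. An operator in \<open>L\<^sup>2\<close> is represented by its graph,
  i.e. by the set of all pairs of representatives \<open>(f, g)\<close> such that the class of \<open>f\<close> lies in the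
  domain and is mapped to the class of \<open>g\<close>. All graphs and subspaces below are saturated under
  almost everywhere equality, so that equality and inclusion of these sets are
  equality and inclusion of operators and of subspaces of \<open>L\<^sup>2\<close>.
\<close>

definition L2_space :: "'a measure \<Rightarrow> ('a \<Rightarrow> complex) set" where
  "L2_space M = {f \<in> borel_measurable M. integrable M (\<lambda>x. (cmod (f x))\<^sup>2)}"

definition L2_norm :: "'a measure \<Rightarrow> ('a \<Rightarrow> complex) \<Rightarrow> real" where
  "L2_norm M f = sqrt (LINT x|M. (cmod (f x))\<^sup>2)"

definition L2_tendsto :: "'a measure \<Rightarrow> (nat \<Rightarrow> 'a \<Rightarrow> complex) \<Rightarrow> ('a \<Rightarrow> complex) \<Rightarrow> bool" where
  "L2_tendsto M u f \<longleftrightarrow> (\<lambda>n. L2_norm M (\<lambda>x. u n x - f x)) \<longlonglongrightarrow> 0"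

definition ae_saturate :: "'a measure \<Rightarrow> ('a \<Rightarrow> complex) set \<Rightarrow> ('a \<Rightarrow> complex) set" where
  "ae_saturate M S = {f \<in> borel_measurable M. \<exists>g\<in>S. AE x in M. f x = g x}"

type_synonym 'a L2_op = "(('a \<Rightarrow> complex) \<times> ('a \<Rightarrow> complex)) set"

definition op_closure :: "'a measure \<Rightarrow> 'a L2_op \<Rightarrow> 'a L2_op" where
  "op_closure M T = {(f, g). f \<in> L2_space M \<and> g \<in> L2_space M \<and>
     (\<exists>u v. (\<forall>n. (u n, v n) \<in> T) \<and> L2_tendsto M u f \<and> L2_tendsto M v g)}"

definition closed_op :: "'a measure \<Rightarrow> 'a L2_op \<Rightarrow> bool" where
  "closed_op M T \<longleftrightarrow> op_closure M T \<subseteq> T"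

definition densely_defined :: "'a measure \<Rightarrow> 'a L2_op \<Rightarrow> bool" where
  "densely_defined M T \<longleftrightarrow>
     (\<forall>f\<in>L2_space M. \<exists>u. (\<forall>n. u n \<in> Domain T) \<and> L2_tendsto M u f)"

definition op_restrict :: "'a L2_op \<Rightarrow> ('a \<Rightarrow> complex) set \<Rightarrow> 'a L2_op" where
  "op_restrict T S = {(f, g) \<in> T. f \<in> S}"

definition nonsingular :: "'a measure \<Rightarrow> ('a \<Rightarrow> 'a) \<Rightarrow> bool" where
  "nonsingular M T \<longleftrightarrow> absolutely_continuous M (distr M M T)"

definition h_deriv :: "'a measure \<Rightarrow> ('a \<Rightarrow> 'a) \<Rightarrow> 'a \<Rightarrow> ennreal" where
  "h_deriv M T = RN_deriv M (distr M M T)"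

text \<open>This is the graph of an operator only if \<open>T\<close> is nonsingular.\<close>

definition comp_op :: "'a measure \<Rightarrow> ('a \<Rightarrow> 'a) \<Rightarrow> 'a L2_op" where
  "comp_op M T = {(f, g). f \<in> L2_space M \<and> f \<circ> T \<in> L2_space M \<and>
     g \<in> L2_space M \<and> (AE x in M. g x = (f \<circ> T) x)}"

text \<open>
  The sets \<open>X\<^sub>n = space (N n)\<close> are subsets of one common type; \<open>d n m\<close> is the map
  \<open>\<delta>\<^sub>m\<^sup>n\<close> from \<open>X\<^sub>m\<close> to \<open>X\<^sub>n\<close> and is only constrained for \<open>n \<le> m\<close>.
\<close>

locale projective_system =
  fixes N :: "nat \<Rightarrow> 'b measure" and d :: "nat \<Rightarrow> nat \<Rightarrow> 'b \<Rightarrow> 'b"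
  assumes d_measurable: "n \<le> m \<Longrightarrow> d n m \<in> measurable (N m) (N n)"
    and d_surj: "n \<le> m \<Longrightarrow> d n m ` space (N m) = space (N n)"
    and d_comp: "n \<le> m \<Longrightarrow> m \<le> k \<Longrightarrow> x \<in> space (N k) \<Longrightarrow> d n k x = (d n m \<circ> d m k) x"
    and d_id: "x \<in> space (N n) \<Longrightarrow> d n n x = x"

definition cylinder_sets ::
    "(nat \<Rightarrow> 'b measure) \<Rightarrow> 'a measure \<Rightarrow> (nat \<Rightarrow> 'a \<Rightarrow> 'b) \<Rightarrow> 'a set set" where
  "cylinder_sets N M \<delta> = {\<delta> k -` \<sigma> \<inter> space M | k \<sigma>. \<sigma> \<in> sets (N k)}"

locale target_space = projective_system N d
  for N :: "nat \<Rightarrow> 'b measure" and d :: "nat \<Rightarrow> nat \<Rightarrow> 'b \<Rightarrow> 'b" +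
  fixes M :: "'a measure" and \<delta> :: "nat \<Rightarrow> 'a \<Rightarrow> 'b"
  assumes \<delta>_measurable: "\<delta> n \<in> measurable M (N n)"
    and \<delta>_surj: "\<delta> n ` space M = space (N n)"
    and \<delta>_comp: "n \<le> m \<Longrightarrow> x \<in> space M \<Longrightarrow> \<delta> n x = (d n m \<circ> \<delta> m) x"
    and sets_generated: "sets M = sigma_sets (space M) (cylinder_sets N M \<delta>)"
    and emeasure_limit: "\<sigma> \<in> sets (N n) \<Longrightarrow>
      (\<lambda>m. emeasure (N m) (d n m -` \<sigma> \<inter> space (N m)))
        \<longlonglongrightarrow> emeasure M (\<delta> n -` \<sigma> \<inter> space M)"

text \<open>The operator \<open>\<Delta>\<^sub>k\<close> maps \<open>f\<close> to \<open>f \<circ> \<delta> k\<close>.\<close>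

locale isometric_target_space = target_space N d M \<delta>
  for N :: "nat \<Rightarrow> 'b measure" and d :: "nat \<Rightarrow> nat \<Rightarrow> 'b \<Rightarrow> 'b"
    and M :: "'a measure" and \<delta> :: "nat \<Rightarrow> 'a \<Rightarrow> 'b" +
  assumes N_sigma_finite: "sigma_finite_measure (N k)"
    and \<delta>_abs_continuous: "absolutely_continuous (N k) (distr M (N k) (\<delta> k))"
    and RN_bounded: "\<exists>c::real. AE x in N k. RN_deriv (N k) (distr M (N k) (\<delta> k)) x \<le> ennreal c"
    and \<Delta>_isometry: "f \<in> L2_space (N k) \<Longrightarrow>
      f \<circ> \<delta> k \<in> L2_space M \<and> L2_norm M (f \<circ> \<delta> k) = L2_norm (N k) f"

definition \<Delta>_range ::
    "(nat \<Rightarrow> 'b measure) \<Rightarrow> 'a measure \<Rightarrow> (nat \<Rightarrow> 'a \<Rightarrow> 'b) \<Rightarrow> ('a \<Rightarrow> complex) set" where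
  "\<Delta>_range N M \<delta> = (\<Union>n. ae_saturate M {f \<circ> \<delta> n | f. f \<in> L2_space (N n)})"

definition scr_F ::
    "(nat \<Rightarrow> 'b measure) \<Rightarrow> 'a measure \<Rightarrow> (nat \<Rightarrow> 'a \<Rightarrow> 'b) \<Rightarrow> ('a \<Rightarrow> complex) set" where
  "scr_F N M \<delta> = ae_saturate M
     {(\<lambda>x. \<Sum>i<n. c i * indicator (s i) x) | (n::nat) (c :: nat \<Rightarrow> complex) s.
        \<forall>i<n. s i \<in> sets M \<and> emeasure M (s i) < \<infinity> \<and> indicator (s i) \<in> \<Delta>_range N M \<delta>}"

definition scr_F_tilde ::
    "(nat \<Rightarrow> 'b measure) \<Rightarrow> 'a measure \<Rightarrow> (nat \<Rightarrow> 'a \<Rightarrow> 'b) \<Rightarrow> (nat \<Rightarrow> 'a set)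
      \<Rightarrow> ('a \<Rightarrow> complex) set" where
  "scr_F_tilde N M \<delta> Y =
     ae_saturate M {(\<lambda>x. indicator (Y k) x * f x) | k f. f \<in> scr_F N M \<delta>}"

text \<open>
  In the following definition \<open>u = \<Delta>\<^sub>k f\<close>. The function \<open>g m\<close> represents
  \<open>C\<^sub>m \<Delta>\<^sub>k\<^sup>m f\<close> for \<open>m \<ge> m0\<close>; its existence says that \<open>\<Delta>\<^sub>k\<^sup>m f\<close> is in the domain of
  \<open>C\<^sub>m\<close>, that is, \<open>u \<in> D\<^sub>\<infinity>\<close>.
\<close>

definition lim_op ::
    "(nat \<Rightarrow> 'b measure) \<Rightarrow> (nat \<Rightarrow> nat \<Rightarrow> 'b \<Rightarrow> 'b) \<Rightarrow> 'a measure \<Rightarrow> (nat \<Rightarrow> 'a \<Rightarrow> 'b)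
      \<Rightarrow> (nat \<Rightarrow> 'b L2_op) \<Rightarrow> 'a L2_op" where
  "lim_op N d M \<delta> C = {(u, v). u \<in> L2_space M \<and> v \<in> L2_space M \<and>
     (\<exists>k. \<exists>f\<in>L2_space (N k). \<exists>g. (AE x in M. u x = (f \<circ> \<delta> k) x) \<and>
        (\<exists>m0\<ge>k. \<forall>m\<ge>m0. (f \<circ> d k m, g m) \<in> C m) \<and>
        L2_tendsto M (\<lambda>m. g m \<circ> \<delta> m) v)}"

text \<open>Functions on \<open>[0,\<infinity>)\<close> are represented by functions on the reals; their values at negative
  arguments are irrelevant.\<close>

definition scr_M ::
    "(nat \<Rightarrow> 'a measure) \<Rightarrow> (nat \<Rightarrow> 'a \<Rightarrow> 'c::real_normed_vector) \<Rightarrow> (real \<Rightarrow> real) set" where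
  "scr_M \<nu> f = {G. (\<forall>t\<ge>0. 0 \<le> G t) \<and> mono_on {0..} G \<and> convex_on {0..} G \<and>
     filterlim (\<lambda>t. G t / t) at_top at_top \<and>
     (SUP n. \<integral>\<^sup>+ x. ennreal (G (norm (f n x))) \<partial>\<nu> n) < \<infinity>}"

end

theory Submission
  imports Defs
begin

text \<open>
  The isometry property, tested on indicator functions, says that \<open>\<delta> k\<close> transports \<open>M\<close> to
  \<open>N k\<close> (\<open>distr_\<delta>\<close>). Everything can therefore be computed on \<open>M\<close>. In particular the measures of
  the transported system are the measures of the preimages under \<open>d k n \<circ> An n \<circ> \<delta> n\<close>, and these
  converge because the measures of the symmetric differences tend to \<open>0\<close>. This is the first
  assertion (\<open>transported_target_space\<close>).

  For the second assertion the main point is that \<open>A\<close> is nonsingular (\<open>A_nonsingular\<close>). On a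
  cylinder set \<open>C\<close> the image measure of \<open>M\<close> under \<open>A\<close> is the limit of the integrals of the
  densities \<open>h_deriv (N n) (An n) \<circ> \<delta> n\<close> over \<open>C\<close>. A function in \<open>scr_M\<close> makes these densities
  uniformly integrable on \<open>Y k\<close>. So for every \<open>e > 0\<close> there is a \<open>T\<close> such that the image measure
  is at most \<open>T * emeasure M C + e\<close> for all cylinder sets \<open>C \<subseteq> Y k\<close> (\<open>cylinder_bound\<close>). Cylinder
  sets form an algebra that generates the measurable sets, and every measurable
  subset of a cylinder set on which both measures are finite can be approximated by cylinder sets
  in both measures at once. This extends the inequality to all such subsets
  (\<open>inequality_extends_from_algebra\<close>), so null sets are null sets of the image measure.

  Once \<open>A\<close> is nonsingular, \<open>comp_op M A\<close> is closed, by almost everywhere convergence along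
  subsequences. Up to null sets, the elements of \<open>scr_F_tilde\<close> are step functions over cylinder
  sets inside some \<open>Y k\<close>. For them the functions in the definition of \<open>lim_op\<close> are step functions
  over preimages, and the \<open>L\<^sup>2\<close> distance of two indicator functions is governed by the measure of
  the symmetric difference. Hence on \<open>scr_F_tilde\<close> the operator \<open>lim_op\<close> exists and coincides with
  \<open>comp_op M A\<close> (\<open>restrict_lim_eq_restrict_comp\<close>). Finally, the graph norm of \<open>comp_op M A\<close> is the
  norm of \<open>L\<^sup>2\<close> for the sum of \<open>M\<close> and its image measure under \<open>A\<close>. This measure is finite on an
  exhaustion by cylinder sets, so step functions over cylinder sets are dense in the graph norm
  (\<open>step_funs_dense\<close>, \<open>comp_op_subset_closure\<close>), and the closure is all of \<open>comp_op M A\<close>.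
\<close>

section \<open>Square-integrable functions and step functions\<close>

text \<open>
  The square of the \<open>L\<^sup>2\<close> norm, as an extended nonnegative number: it can be added, compared
  and transported along maps without integrability side conditions, and a measurable \<open>f\<close> lies
  in \<open>L\<^sup>2\<close> exactly when it is finite.
\<close>

definition energy :: "'a measure \<Rightarrow> ('a \<Rightarrow> complex) \<Rightarrow> ennreal" where
  "energy M f = (\<integral>\<^sup>+x. ennreal ((cmod (f x))\<^sup>2) \<partial>M)"

definition step_fun :: "nat \<Rightarrow> (nat \<Rightarrow> complex) \<Rightarrow> (nat \<Rightarrow> 'a set) \<Rightarrow> 'a \<Rightarrow> complex" where
  "step_fun n c s = (\<lambda>x. \<Sum>i<n. c i * indicator (s i) x)"

lemma L2_space_iff: "f \<in> L2_space M \<longleftrightarrow> f \<in> borel_measurable M \<and> energy M f < \<infinity>"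
  unfolding L2_space_def energy_def by (auto simp: integrable_iff_bounded)

lemma L2_norm_energy:
  assumes "f \<in> borel_measurable M"
  shows "L2_norm M f = sqrt (enn2real (energy M f))"
  unfolding L2_norm_def energy_def using assms by (subst integral_eq_nn_integral) auto

lemma energy_cong_AE: "AE x in M. f x = g x \<Longrightarrow> energy M f = energy M g"
  unfolding energy_def by (intro nn_integral_cong_AE) auto

text \<open>
  The factor \<open>2\<close> is harmless, because only finiteness and convergence to \<open>0\<close> are ever at
  stake; it spares the Minkowski inequality.
\<close>

lemma energy_add_le:
  assumes [measurable]: "f \<in> borel_measurable M" "g \<in> borel_measurable M"
  shows "energy M (\<lambda>x. f x + g x) \<le> 2 * energy M f + 2 * energy M g"
proof -
  have "ennreal ((cmod (f x + g x))\<^sup>2) \<le> 2 * ennreal ((cmod (f x))\<^sup>2) + 2 * ennreal ((cmod (g x))\<^sup>2)" for x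
  proof -
    have "(cmod (f x + g x))\<^sup>2 \<le> (cmod (f x) + cmod (g x))\<^sup>2"
      by (simp add: norm_triangle_ineq power_mono)
    also have "\<dots> \<le> 2 * (cmod (f x))\<^sup>2 + 2 * (cmod (g x))\<^sup>2"
      using sum_squares_bound[of "cmod (f x)" "cmod (g x)"] by (simp add: power2_sum)
    finally have "ennreal ((cmod (f x + g x))\<^sup>2) \<le> ennreal (2 * (cmod (f x))\<^sup>2 + 2 * (cmod (g x))\<^sup>2)"
      by (rule ennreal_leI)
    then show ?thesis by (simp add: ennreal_mult ennreal_plus)
  qed
  then have "energy M (\<lambda>x. f x + g x) \<le> (\<integral>\<^sup>+x. 2 * ennreal ((cmod (f x))\<^sup>2) + 2 * ennreal ((cmod (g x))\<^sup>2) \<partial>M)"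
    unfolding energy_def by (intro nn_integral_mono)
  also have "\<dots> = 2 * energy M f + 2 * energy M g"
    unfolding energy_def by (simp add: nn_integral_add nn_integral_cmult)
  finally show ?thesis .
qed

lemma energy_minus_commute: "energy M (\<lambda>x. f x - g x) = energy M (\<lambda>x. g x - f x)"
  unfolding energy_def by (simp add: norm_minus_commute)

lemma energy_diff_triangle:
  assumes [measurable]: "f \<in> borel_measurable M" "g \<in> borel_measurable M" "h \<in> borel_measurable M"
  shows "energy M (\<lambda>x. f x - h x) \<le> 2 * energy M (\<lambda>x. f x - g x) + 2 * energy M (\<lambda>x. g x - h x)"
  using energy_add_le[of "\<lambda>x. f x - g x" M "\<lambda>x. g x - h x"] by simp

lemma L2_space_diff:
  assumes "f \<in> L2_space M" "g \<in> L2_space M"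
  shows "(\<lambda>x. f x - g x) \<in> L2_space M"
proof -
  have m[measurable]: "f \<in> borel_measurable M" "g \<in> borel_measurable M"
    and fin: "energy M f < \<infinity>" "energy M g < \<infinity>"
    using assms by (auto simp: L2_space_iff)
  have "energy M (\<lambda>x. f x - g x) \<le> 2 * energy M f + 2 * energy M g"
    using energy_diff_triangle[of f M "\<lambda>_. 0" g] by (simp add: energy_def)
  also have "\<dots> < \<infinity>" using fin by (simp add: ennreal_mult_less_top)
  finally show ?thesis by (simp add: L2_space_iff)
qed

text \<open>
  The real-valued \<open>L2_norm\<close> is \<open>0\<close> also for functions that are not square integrable, so
  convergence in that norm means what it should only for sequences that lie eventually in
  \<open>L\<^sup>2\<close>.
\<close>

lemma L2_tendsto_iff_energy:
  assumes u: "\<forall>\<^sub>F n in sequentially. u n \<in> L2_space M" and f: "f \<in> L2_space M"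
  shows "L2_tendsto M u f \<longleftrightarrow> (\<lambda>n. energy M (\<lambda>x. u n x - f x)) \<longlonglongrightarrow> 0"
proof -
  let ?e = "\<lambda>n. energy M (\<lambda>x. u n x - f x)"
  have ev: "\<forall>\<^sub>F n in sequentially. L2_norm M (\<lambda>x. u n x - f x) = sqrt (enn2real (?e n)) \<and> ?e n < \<infinity>"
    using u
  proof eventually_elim
    case (elim n)
    then have "(\<lambda>x. u n x - f x) \<in> L2_space M" using f L2_space_diff by blast
    then show ?case by (auto simp: L2_space_iff L2_norm_energy)
  qed
  have "L2_tendsto M u f \<longleftrightarrow> (\<lambda>n. sqrt (enn2real (?e n))) \<longlonglongrightarrow> 0"
    unfolding L2_tendsto_def by (intro tendsto_cong) (use ev in \<open>auto elim: eventually_mono\<close>)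
  also have "\<dots> \<longleftrightarrow> (\<lambda>n. enn2real (?e n)) \<longlonglongrightarrow> 0"
  proof
    assume "(\<lambda>n. sqrt (enn2real (?e n))) \<longlonglongrightarrow> 0"
    from tendsto_power[OF this, of 2] show "(\<lambda>n. enn2real (?e n)) \<longlonglongrightarrow> 0" by simp
  next
    assume "(\<lambda>n. enn2real (?e n)) \<longlonglongrightarrow> 0"
    from tendsto_real_sqrt[OF this] show "(\<lambda>n. sqrt (enn2real (?e n))) \<longlonglongrightarrow> 0" by simp
  qed
  also have "\<dots> \<longleftrightarrow> ?e \<longlonglongrightarrow> 0"
  proof
    assume "(\<lambda>n. enn2real (?e n)) \<longlonglongrightarrow> 0"
    then have "(\<lambda>n. ennreal (enn2real (?e n))) \<longlonglongrightarrow> ennreal 0" by (rule tendsto_ennrealI)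
    moreover have "\<forall>\<^sub>F n in sequentially. ennreal (enn2real (?e n)) = ?e n"
      using ev by eventually_elim simp
    ultimately show "?e \<longlonglongrightarrow> 0" using Lim_transform_eventually by fastforce
  next
    assume "?e \<longlonglongrightarrow> 0"
    then have "?e \<longlonglongrightarrow> ennreal 0" by simp
    then show "(\<lambda>n. enn2real (?e n)) \<longlonglongrightarrow> 0" by (rule tendsto_enn2real) simp
  qed
  finally show ?thesis .
qed

lemma energy_eq_0_imp_AE:
  assumes [measurable]: "f \<in> borel_measurable M" and "energy M f = 0"
  shows "AE x in M. f x = 0"
proof -
  have "AE x in M. ennreal ((cmod (f x))\<^sup>2) = 0"
    using assms(2) unfolding energy_def by (subst (asm) nn_integral_0_iff_AE) auto
  then show ?thesis by eventually_elim (simp add: ennreal_eq_0_iff)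
qed

lemma L2_tendsto_unique:
  assumes u: "\<forall>\<^sub>F n in sequentially. u n \<in> L2_space M" and f: "f \<in> L2_space M" and g: "g \<in> L2_space M"
    and lim: "L2_tendsto M u f" "L2_tendsto M u g"
  shows "AE x in M. f x = g x"
proof -
  have [measurable]: "f \<in> borel_measurable M" "g \<in> borel_measurable M"
    using f g by (auto simp: L2_space_iff)
  have "(\<lambda>n. 2 * energy M (\<lambda>x. u n x - f x) + 2 * energy M (\<lambda>x. u n x - g x)) \<longlonglongrightarrow> 2 * 0 + 2 * 0"
    using lim L2_tendsto_iff_energy[OF u] f g
    by (intro tendsto_add ennreal_tendsto_cmult) auto
  moreover have "\<forall>\<^sub>F n in sequentially. energy M (\<lambda>x. f x - g x)
     \<le> 2 * energy M (\<lambda>x. u n x - f x) + 2 * energy M (\<lambda>x. u n x - g x)"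
    using u
  proof eventually_elim
    case (elim n)
    then have [measurable]: "u n \<in> borel_measurable M" by (auto simp: L2_space_iff)
    show ?case using energy_diff_triangle[of f M "u n" g] by (simp add: energy_minus_commute[of M f])
  qed
  ultimately have "energy M (\<lambda>x. f x - g x) \<le> 2 * 0 + 2 * 0"
    using tendsto_lowerbound by fastforce
  then have "AE x in M. f x - g x = 0" by (intro energy_eq_0_imp_AE) auto
  then show ?thesis by eventually_elim simp
qed

lemma L2_tendsto_cong_AE:
  assumes "\<forall>\<^sub>F n in sequentially. AE x in M. u n x = u' n x"
    "\<forall>\<^sub>F n in sequentially. u n \<in> L2_space M" "\<forall>\<^sub>F n in sequentially. u' n \<in> L2_space M"
    "AE x in M. f x = f' x" "f \<in> L2_space M" "f' \<in> L2_space M"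
  shows "L2_tendsto M u f \<longleftrightarrow> L2_tendsto M u' f'"
proof -
  have "\<forall>\<^sub>F n in sequentially. energy M (\<lambda>x. u n x - f x) = energy M (\<lambda>x. u' n x - f' x)"
    using assms(1)
  proof eventually_elim
    case (elim n)
    then have "AE x in M. u n x - f x = u' n x - f' x" using assms(4) by eventually_elim simp
    then show ?case by (rule energy_cong_AE)
  qed
  then have "(\<lambda>n. energy M (\<lambda>x. u n x - f x)) \<longlonglongrightarrow> 0 \<longleftrightarrow> (\<lambda>n. energy M (\<lambda>x. u' n x - f' x)) \<longlonglongrightarrow> 0"
    by (rule tendsto_cong)
  then show ?thesis using assms by (simp add: L2_tendsto_iff_energy)
qed

lemma L2_space_cong_AE:
  assumes "AE x in M. f x = g x" "f \<in> L2_space M" "g \<in> borel_measurable M"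
  shows "g \<in> L2_space M"
  using assms energy_cong_AE[OF assms(1)] by (simp add: L2_space_iff)

lemma energy_sum_le:
  assumes [measurable]: "\<And>i. i < n \<Longrightarrow> h i \<in> borel_measurable M"
  shows "energy M (\<lambda>x. \<Sum>i<n. c i * h i x)
    \<le> of_nat n * (\<Sum>i<n. ennreal ((cmod (c i))\<^sup>2) * energy M (h i))"
proof -
  have "ennreal ((cmod (\<Sum>i<n. c i * h i x))\<^sup>2)
     \<le> of_nat n * (\<Sum>i<n. ennreal ((cmod (c i))\<^sup>2) * ennreal ((cmod (h i x))\<^sup>2))" for x
  proof -
    have "(cmod (\<Sum>i<n. c i * h i x))\<^sup>2 \<le> (\<Sum>i<n. cmod (c i) * cmod (h i x))\<^sup>2"
      by (intro power_mono sum_norm_le) (auto simp: norm_mult)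
    also have "\<dots> \<le> real n * (\<Sum>i<n. (cmod (c i))\<^sup>2 * (cmod (h i x))\<^sup>2)"
      using sum_squared_le_sum_of_squares[of "\<lambda>i. cmod (c i) * cmod (h i x)" "{..<n}"]
      by (simp add: power_mult_distrib mult.commute)
    finally have "ennreal ((cmod (\<Sum>i<n. c i * h i x))\<^sup>2)
      \<le> ennreal (real n * (\<Sum>i<n. (cmod (c i))\<^sup>2 * (cmod (h i x))\<^sup>2))"
      by (rule ennreal_leI)
    also have "\<dots> = of_nat n * (\<Sum>i<n. ennreal ((cmod (c i))\<^sup>2) * ennreal ((cmod (h i x))\<^sup>2))"
      by (simp add: ennreal_mult sum_nonneg flip: sum_ennreal ennreal_of_nat_eq_real_of_nat)
    finally show ?thesis .
  qed
  then have "energy M (\<lambda>x. \<Sum>i<n. c i * h i x)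
     \<le> (\<integral>\<^sup>+x. of_nat n * (\<Sum>i<n. ennreal ((cmod (c i))\<^sup>2) * ennreal ((cmod (h i x))\<^sup>2)) \<partial>M)"
    unfolding energy_def by (intro nn_integral_mono)
  also have "\<dots> = of_nat n * (\<Sum>i<n. ennreal ((cmod (c i))\<^sup>2) * energy M (h i))"
  proof -
    have "(\<integral>\<^sup>+x. (\<Sum>i<n. ennreal ((cmod (c i))\<^sup>2) * ennreal ((cmod (h i x))\<^sup>2)) \<partial>M)
      = (\<Sum>i<n. \<integral>\<^sup>+x. ennreal ((cmod (c i))\<^sup>2) * ennreal ((cmod (h i x))\<^sup>2) \<partial>M)"
      by (rule nn_integral_sum) auto
    also have "\<dots> = (\<Sum>i<n. ennreal ((cmod (c i))\<^sup>2) * energy M (h i))"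
      unfolding energy_def by (intro sum.cong nn_integral_cmult) auto
    finally show ?thesis by (subst nn_integral_cmult) auto
  qed
  finally show ?thesis .
qed

text \<open>
  This identity turns the hypothesis on symmetric differences of preimages into \<open>L\<^sup>2\<close>
  convergence of indicator functions, and, by the next lemmas, of step functions.
\<close>

lemma energy_indicator_diff:
  assumes "A \<in> sets M" "B \<in> sets M"
  shows "energy M (\<lambda>x. indicator A x - indicator B x) = emeasure M (sym_diff A B)"
proof -
  have "ennreal ((cmod (indicator A x - indicator B x))\<^sup>2) = indicator (sym_diff A B) x" for x
    by (auto simp: indicator_def)
  then show ?thesis using assms unfolding energy_def by simp
qed

lemma step_fun_measurable:
  assumes "\<And>i. i < n \<Longrightarrow> s i \<in> sets M"
  shows "step_fun n c s \<in> borel_measurable M"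
  unfolding step_fun_def using assms by measurable

lemma energy_step_fun_diff:
  assumes "\<And>i. i < n \<Longrightarrow> s i \<in> sets M" "\<And>i. i < n \<Longrightarrow> t i \<in> sets M"
  shows "energy M (\<lambda>x. step_fun n c s x - step_fun n c t x)
     \<le> of_nat n * (\<Sum>i<n. ennreal ((cmod (c i))\<^sup>2) * emeasure M (sym_diff (s i) (t i)))"
proof -
  have "step_fun n c s x - step_fun n c t x = (\<Sum>i<n. c i * (indicator (s i) x - indicator (t i) x))" for x
    by (simp add: step_fun_def sum_subtractf algebra_simps)
  then have "energy M (\<lambda>x. step_fun n c s x - step_fun n c t x)
     \<le> of_nat n * (\<Sum>i<n. ennreal ((cmod (c i))\<^sup>2) * energy M (\<lambda>x. indicator (s i) x - indicator (t i) x))"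
    using energy_sum_le[of n "\<lambda>i x. indicator (s i) x - indicator (t i) x" M c] assms by simp
  also have "\<dots> = of_nat n * (\<Sum>i<n. ennreal ((cmod (c i))\<^sup>2) * emeasure M (sym_diff (s i) (t i)))"
    using assms by (intro arg_cong2[where f = "(*)"] sum.cong) (auto simp: energy_indicator_diff)
  finally show ?thesis .
qed

lemma step_fun_L2:
  assumes "\<And>i. i < n \<Longrightarrow> s i \<in> sets M" "\<And>i. i < n \<Longrightarrow> emeasure M (s i) < \<infinity>"
  shows "step_fun n c s \<in> L2_space M"
proof -
  have "energy M (step_fun n c s) \<le> of_nat n * (\<Sum>i<n. ennreal ((cmod (c i))\<^sup>2) * emeasure M (s i))"
    using energy_step_fun_diff[of n s M "\<lambda>_. {}" c] assms(1) by (simp add: step_fun_def)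
  also have "\<dots> < \<infinity>"
    using assms(2) by (auto simp: ennreal_mult_less_top of_nat_less_top)
  finally show ?thesis using step_fun_measurable[of n s M c] assms(1) by (simp add: L2_space_iff)
qed

lemma step_fun_vimage: "step_fun n c s (T x) = step_fun n c (\<lambda>i. T -` s i) x"
  by (simp add: step_fun_def indicator_def)

lemma step_fun_cong:
  "(\<And>i. i < n \<Longrightarrow> x \<in> s i \<longleftrightarrow> x \<in> t i) \<Longrightarrow> step_fun n c s x = step_fun n c t x"
  by (auto simp: step_fun_def indicator_def intro!: sum.cong)

lemma step_fun_tendsto:
  assumes t: "\<And>i. i < n \<Longrightarrow> t i \<in> sets M"
    and s: "\<forall>\<^sub>F m in sequentially. \<forall>i<n. s m i \<in> sets M"
    and lim: "\<And>i. i < n \<Longrightarrow> (\<lambda>m. emeasure M (sym_diff (s m i) (t i))) \<longlonglongrightarrow> 0"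
  shows "(\<lambda>m. energy M (\<lambda>x. step_fun n c (s m) x - step_fun n c t x)) \<longlonglongrightarrow> 0"
proof -
  let ?b = "\<lambda>m. of_nat n * (\<Sum>i<n. ennreal ((cmod (c i))\<^sup>2) * emeasure M (sym_diff (s m i) (t i)))"
  have "?b \<longlonglongrightarrow> of_nat n * (\<Sum>i<n. ennreal ((cmod (c i))\<^sup>2) * 0)"
    using lim by (intro ennreal_tendsto_cmult tendsto_sum) (auto simp: of_nat_less_top)
  then have b0: "?b \<longlonglongrightarrow> 0" by simp
  have "\<forall>\<^sub>F m in sequentially. energy M (\<lambda>x. step_fun n c (s m) x - step_fun n c t x) \<le> ?b m"
    using s by eventually_elim (use t in \<open>auto intro: energy_step_fun_diff\<close>)
  then show ?thesis
    by (rule tendsto_sandwich[OF _ _ tendsto_const b0, rotated]) simp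
qed

lemma energy_distr:
  assumes [measurable]: "T \<in> measurable M K" "f \<in> borel_measurable K"
  shows "energy (distr M K T) f = energy M (f \<circ> T)"
  unfolding energy_def by (simp add: nn_integral_distr)

section \<open>Approximation by the sets of a generating algebra\<close>

text \<open>
  The sets that can be approximated form a Dynkin system: a complement is approximated by the
  complement, and a countable disjoint union by the finite union that approximates its first
  \<open>n\<close> members, where \<open>n\<close> makes the measure of the other members small.
\<close>

lemma algebra_approximation:
  assumes "finite_measure R" and alg: "algebra (space R) G"
    and gen: "sets R = sigma_sets (space R) G"
    and E: "E \<in> sets R" and e: "(0::real) < e"
  shows "\<exists>C\<in>G. measure R (sym_diff E C) < e"
proof -
  interpret finite_measure R by fact
  interpret G: algebra "space R" G by fact
  have sub: "C \<in> G \<Longrightarrow> C \<in> sets R" for C unfolding gen by auto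
  from E have "E \<in> sigma_sets (space R) G" unfolding gen .
  then have "\<forall>e>0. \<exists>C\<in>G. measure R (sym_diff E C) < e"
  proof (induction rule: sigma_sets_induct_disjoint[OF G.Int_stable G.space_closed, consumes 1, case_names basic empty compl union])
    case (basic A)
    then show ?case by (intro allI impI bexI[of _ A]) auto
  next
    case empty
    then show ?case by (intro allI impI bexI[of _ "{}"]) auto
  next
    case (compl A)
    have A: "A \<subseteq> space R" using compl.hyps sets.sets_into_space unfolding gen[symmetric] by auto
    show ?case
    proof (intro allI impI)
      fix e :: real assume "0 < e"
      then obtain C where C: "C \<in> G" "measure R (sym_diff A C) < e" using compl.IH by auto
      have "sym_diff (space R - A) (space R - C) = sym_diff A C"
        using A G.sets_into_space[OF C(1)] by auto
      then show "\<exists>C\<in>G. measure R (sym_diff (space R - A) C) < e"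
        using C by (intro bexI[of _ "space R - C"]) auto
    qed
  next
    case (union A)
    then have [measurable]: "A i \<in> sets R" for i unfolding gen by auto
    show ?case
    proof (intro allI impI)
      fix e :: real assume e: "0 < e"
      have "(\<lambda>i. measure R (A i)) sums measure R (\<Union>i. A i)"
        using union.hyps by (intro finite_measure_UNION) auto
      then have "(\<lambda>n. measure R (\<Union>i. A i) - (\<Sum>i<n. measure R (A i))) \<longlonglongrightarrow> measure R (\<Union>i. A i) - measure R (\<Union>i. A i)"
        unfolding sums_def by (intro tendsto_diff tendsto_const)
      then have "\<forall>\<^sub>F n in sequentially. measure R (\<Union>i. A i) - (\<Sum>i<n. measure R (A i)) < e/2"
        using e by (intro order_tendstoD) auto
      then obtain n where n: "measure R (\<Union>i. A i) - (\<Sum>i<n. measure R (A i)) < e/2"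
        by (auto simp: eventually_sequentially)
      (* n errors of size e' must add up to at most e/2; n + 1 avoids a division by 0 when n = 0 *)
      define e' where "e' = e / (2 * (real n + 1))"
      have e': "0 < e'" "real n * e' \<le> e/2"
        using e unfolding e'_def by (auto simp: field_simps)
      have "\<forall>i. \<exists>C. C \<in> G \<and> measure R (sym_diff (A i) C) < e'"
        using union.IH e'(1) by blast
      from choice[OF this] obtain C where "\<forall>i. C i \<in> G \<and> measure R (sym_diff (A i) (C i)) < e'" ..
      then have C: "\<And>i. C i \<in> G" "\<And>i. measure R (sym_diff (A i) (C i)) < e'" by auto
      note [measurable] = sub[OF C(1)]
      have UC: "(\<Union>i<n. C i) \<in> G" using C(1) by (intro G.finite_UN) auto
      have "sym_diff (\<Union>i. A i) (\<Union>i<n. C i) \<subseteq> ((\<Union>i. A i) - (\<Union>i<n. A i)) \<union> (\<Union>i<n. sym_diff (A i) (C i))"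
        by auto
      then have "measure R (sym_diff (\<Union>i. A i) (\<Union>i<n. C i))
        \<le> measure R (((\<Union>i. A i) - (\<Union>i<n. A i)) \<union> (\<Union>i<n. sym_diff (A i) (C i)))"
        by (intro finite_measure_mono) auto
      also have "\<dots> \<le> measure R ((\<Union>i. A i) - (\<Union>i<n. A i)) + measure R (\<Union>i<n. sym_diff (A i) (C i))"
        by (intro measure_Un_le) auto
      also have "measure R ((\<Union>i. A i) - (\<Union>i<n. A i)) = measure R (\<Union>i. A i) - (\<Sum>i<n. measure R (A i))"
      proof -
        have "measure R (\<Union>i<n. A i) = (\<Sum>i<n. measure R (A i))"
          using union.hyps by (intro finite_measure_finite_Union) (auto simp: disjoint_family_on_def)
        then show ?thesis by (subst finite_measure_Diff) auto
      qed
      also have "measure R (\<Union>i<n. sym_diff (A i) (C i)) \<le> (\<Sum>i<n. measure R (sym_diff (A i) (C i)))"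
        by (intro finite_measure_subadditive_finite) auto
      also have "\<dots> \<le> (\<Sum>i<n. e')" using C(2) by (intro sum_mono less_imp_le)
      also have "\<dots> \<le> e/2" using e'(2) by simp
      finally have "measure R (sym_diff (\<Union>i. A i) (\<Union>i<n. C i)) < e" using n by simp
      then show "\<exists>C\<in>G. measure R (sym_diff (\<Union>i. A i) C) < e" using UC by auto
    qed
  qed
  then show ?thesis using e by auto
qed

text \<open>
  Sets of infinite measure cannot be approximated globally. An exhaustion by sets of the algebra
  of finite measure localizes the preceding lemma to finite measures.
\<close>

locale algebra_exhaustion = algebra "space R" G
  for R :: "'a measure" and G :: "'a set set" +
  fixes W :: "nat \<Rightarrow> 'a set"
  assumes generates: "sets R = sigma_sets (space R) G"
    and W_in: "W k \<in> G"
    and W_inc: "incseq W"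
    and W_exhausts: "(\<Union>k. W k) = space R"
    and W_finite: "emeasure R (W k) < \<infinity>"
begin

lemma G_sets: "C \<in> G \<Longrightarrow> C \<in> sets R"
  unfolding generates by auto

lemma localized_approximation:
  assumes B[measurable]: "B \<in> sets R" and e: "(0::real) < e"
  shows "\<exists>C\<in>G. C \<subseteq> W k \<and> emeasure R (sym_diff C (B \<inter> W k)) < ennreal e"
proof -
  note [measurable] = G_sets[OF W_in]
  let ?R = "density R (indicator (W k))"
  have em: "emeasure ?R X = emeasure R (W k \<inter> X)" if [measurable]: "X \<in> sets R" for X
    by (simp add: emeasure_density nn_integral_indicator flip: indicator_inter_arith)
  interpret fin: finite_measure ?R
  proof
    show "emeasure ?R (space ?R) \<noteq> \<infinity>"
      using W_finite[of k] by (simp add: em less_top[symmetric])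
  qed
  have "\<exists>C\<in>G. measure ?R (sym_diff B C) < e"
    by (rule algebra_approximation)
      (use fin.finite_measure_axioms algebra_axioms generates e B in simp_all)
  then obtain C where C: "C \<in> G" "measure ?R (sym_diff B C) < e" by blast
  note [measurable] = G_sets[OF C(1)]
  have "emeasure R (sym_diff (C \<inter> W k) (B \<inter> W k)) = emeasure R (W k \<inter> sym_diff B C)"
    by (rule arg_cong[where f = "emeasure R"]) auto
  also have "\<dots> = ennreal (measure ?R (sym_diff B C))"
    by (subst em[symmetric]) (auto simp: fin.emeasure_eq_measure)
  also have "\<dots> < ennreal e" using C(2) e by (simp add: ennreal_lessI)
  finally show ?thesis using C(1) W_in by (intro bexI[of _ "C \<inter> W k"]) auto
qed

lemma finite_measure_set_approximation:
  assumes B[measurable]: "B \<in> sets R" and fin: "emeasure R B < \<infinity>"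
  obtains C where "\<And>m. C m \<in> G" "\<And>m. \<exists>k. C m \<subseteq> W k"
    "(\<lambda>m. emeasure R (sym_diff (C m) B)) \<longlonglongrightarrow> 0"
proof -
  note [measurable] = G_sets[OF W_in]
  have "\<forall>m. \<exists>C\<in>G. C \<subseteq> W m \<and> emeasure R (sym_diff C (B \<inter> W m)) < ennreal (1 / (real m + 1))"
    by (intro allI localized_approximation) auto
  then obtain C where C: "\<And>m. C m \<in> G" "\<And>m. C m \<subseteq> W m"
    "\<And>m. emeasure R (sym_diff (C m) (B \<inter> W m)) < ennreal (1 / (real m + 1))"
    by metis
  note [measurable] = G_sets[OF C(1)]
  have lim: "(\<lambda>m. emeasure R (B - W m)) \<longlonglongrightarrow> emeasure R (\<Inter>m. B - W m)"
  proof (rule Lim_emeasure_decseq)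
    show "emeasure R (B - W m) \<noteq> \<infinity>" for m
      using emeasure_mono[of "B - W m" B R] fin by (auto simp: top_unique)
  qed (use W_inc in \<open>auto simp: decseq_def incseq_def\<close>)
  have empty: "(\<Inter>m. B - W m) = {}" using W_exhausts sets.sets_into_space[OF B] by auto
  have 1: "(\<lambda>m. emeasure R (B - W m)) \<longlonglongrightarrow> 0"
    using lim unfolding empty emeasure_empty .
  have "(\<lambda>m. 1 / (real m + 1)) \<longlonglongrightarrow> 0"
    using LIMSEQ_inverse_real_of_nat by (simp add: inverse_eq_divide add.commute)
  then have 2: "(\<lambda>m. ennreal (1 / (real m + 1))) \<longlonglongrightarrow> 0"
    using tendsto_ennrealI by fastforce
  have 3: "(\<lambda>m. ennreal (1 / (real m + 1)) + emeasure R (B - W m)) \<longlonglongrightarrow> 0"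
    using tendsto_add[OF 2 1] by simp
  have le: "emeasure R (sym_diff (C m) B) \<le> ennreal (1 / (real m + 1)) + emeasure R (B - W m)" for m
  proof -
    have "emeasure R (sym_diff (C m) B) \<le> emeasure R (sym_diff (C m) (B \<inter> W m) \<union> (B - W m))"
      using C(2)[of m] by (intro emeasure_mono) auto
    also have "\<dots> \<le> emeasure R (sym_diff (C m) (B \<inter> W m)) + emeasure R (B - W m)"
      by (intro emeasure_subadditive) auto
    also have "\<dots> \<le> ennreal (1 / (real m + 1)) + emeasure R (B - W m)"
      using C(3)[of m] by (intro add_mono) auto
    finally show ?thesis .
  qed
  have "(\<lambda>m. emeasure R (sym_diff (C m) B)) \<longlonglongrightarrow> 0"
    by (rule tendsto_sandwich[OF _ always_eventually[OF allI[OF le]] tendsto_const 3]) simp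
  with C(1,2) show ?thesis by (blast intro: that)
qed

end

text \<open>
  The value \<open>0\<close> has to be left out: on every other level set the function is bounded away from
  \<open>0\<close>, which makes the measure of that level set finite.
\<close>

lemma simple_function_L2_step_fun:
  fixes F :: "'a \<Rightarrow> complex"
  assumes F: "simple_function R F" "F \<in> L2_space R"
  obtains n c s where "\<And>i. i < n \<Longrightarrow> s i \<in> sets R" "\<And>i. i < n \<Longrightarrow> emeasure R (s i) < \<infinity>"
    "\<And>x. x \<in> space R \<Longrightarrow> F x = step_fun n c s x"
proof -
  define Y where "Y = F ` space R - {0}"
  have "finite Y" using simple_functionD(1)[OF F(1)] by (simp add: Y_def)
  then obtain c where c: "bij_betw c {..<card Y} Y"
    using ex_bij_betw_nat_finite[of Y] by (auto simp: atLeast0LessThan)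
  define s where "s i = F -` {c i} \<inter> space R" for i
  have s[measurable]: "s i \<in> sets R" for i
    unfolding s_def using simple_functionD(2)[OF F(1)] .
  have "emeasure R (s i) < \<infinity>" if i: "i < card Y" for i
  proof -
    have c0: "c i \<noteq> 0" using c i by (auto simp: bij_betw_def Y_def)
    have "ennreal ((cmod (c i))\<^sup>2) * emeasure R (s i)
       = (\<integral>\<^sup>+x. ennreal ((cmod (c i))\<^sup>2) * indicator (s i) x \<partial>R)"
      by (simp add: nn_integral_cmult_indicator)
    also have "\<dots> \<le> energy R F"
      unfolding energy_def by (intro nn_integral_mono) (auto simp: s_def indicator_def)
    also have "\<dots> < \<infinity>" using F(2) by (simp add: L2_space_iff)
    finally show ?thesis using c0 by (auto simp: ennreal_mult_less_top)
  qed
  moreover have "F x = step_fun (card Y) c s x" if x: "x \<in> space R" for x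
  proof -
    have "step_fun (card Y) c s x = (\<Sum>i<card Y. if c i = F x then c i else 0)"
      unfolding step_fun_def s_def using x by (intro sum.cong) (auto simp: indicator_def)
    also have "\<dots> = (\<Sum>y\<in>Y. if y = F x then y else 0)"
      by (rule sum.reindex_bij_betw[OF c])
    also have "\<dots> = F x" using \<open>finite Y\<close> x by (simp add: Y_def)
    finally show ?thesis by simp
  qed
  ultimately show ?thesis using s that by blast
qed

lemma L2_approx_by_simple_functions:
  assumes f: "f \<in> L2_space R"
  obtains F where "\<And>i. simple_function R (F i)" "\<And>i. F i \<in> L2_space R"
    "(\<lambda>i. energy R (\<lambda>x. F i x - f x)) \<longlonglongrightarrow> 0"
proof -
  have [measurable]: "f \<in> borel_measurable R" and fin: "energy R f < \<infinity>"
    using f by (auto simp: L2_space_iff)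
  obtain F where F: "\<forall>i. simple_function R (F i)" "\<forall>x\<in>space R. (\<lambda>i. F i x) \<longlonglongrightarrow> f x"
    "\<forall>i. \<forall>x\<in>space R. dist (F i x) 0 \<le> 2 * dist (f x) 0"
    using borel_measurable_implies_sequence_metric[of f R 0] by auto
  note F = F[rule_format]
  have [measurable]: "F i \<in> borel_measurable R" for i
    using F(1) by (rule borel_measurable_simple_function)
  (* since |F i| is at most 2 |f|, the squared differences are dominated by 9 |f|^2 *)
  have "(\<lambda>i. \<integral>\<^sup>+x. ennreal ((cmod (F i x - f x))\<^sup>2) \<partial>R) \<longlonglongrightarrow> (\<integral>\<^sup>+x. 0 \<partial>R)"
  proof (rule nn_integral_dominated_convergence)
    show "(\<integral>\<^sup>+x. 9 * ennreal ((cmod (f x))\<^sup>2) \<partial>R) < \<infinity>"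
      using fin by (simp add: nn_integral_cmult energy_def ennreal_mult_less_top)
    show "AE x in R. ennreal ((cmod (F i x - f x))\<^sup>2) \<le> 9 * ennreal ((cmod (f x))\<^sup>2)" for i
    proof (rule AE_I2)
      fix x assume "x \<in> space R"
      then have "cmod (F i x - f x) \<le> 3 * cmod (f x)"
        using F(3)[of x i] norm_triangle_ineq4[of "F i x" "f x"] by simp
      then have "(cmod (F i x - f x))\<^sup>2 \<le> (3 * cmod (f x))\<^sup>2" by (intro power_mono) auto
      then have "ennreal ((cmod (F i x - f x))\<^sup>2) \<le> ennreal (9 * (cmod (f x))\<^sup>2)"
        by (intro ennreal_leI) (simp add: power_mult_distrib)
      then show "ennreal ((cmod (F i x - f x))\<^sup>2) \<le> 9 * ennreal ((cmod (f x))\<^sup>2)"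
        by (simp add: ennreal_mult)
    qed
    show "AE x in R. (\<lambda>i. ennreal ((cmod (F i x - f x))\<^sup>2)) \<longlonglongrightarrow> 0"
    proof (rule AE_I2)
      fix x assume "x \<in> space R"
      then have "(\<lambda>i. (cmod (F i x - f x))\<^sup>2) \<longlonglongrightarrow> (cmod (f x - f x))\<^sup>2"
        using F(2) by (intro tendsto_intros)
      then show "(\<lambda>i. ennreal ((cmod (F i x - f x))\<^sup>2)) \<longlonglongrightarrow> 0"
        using tendsto_ennrealI by fastforce
    qed
  qed auto
  then have "(\<lambda>i. energy R (\<lambda>x. F i x - f x)) \<longlonglongrightarrow> 0" by (simp add: energy_def)
  moreover have "F i \<in> L2_space R" for i
  proof -
    have "energy R (F i) \<le> (\<integral>\<^sup>+x. 4 * ennreal ((cmod (f x))\<^sup>2) \<partial>R)"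
      unfolding energy_def
    proof (intro nn_integral_mono)
      fix x assume "x \<in> space R"
      then have "(cmod (F i x))\<^sup>2 \<le> (2 * cmod (f x))\<^sup>2" using F(3)[of x i] by (intro power_mono) auto
      then have "ennreal ((cmod (F i x))\<^sup>2) \<le> ennreal (4 * (cmod (f x))\<^sup>2)"
        by (intro ennreal_leI) (simp add: power_mult_distrib)
      then show "ennreal ((cmod (F i x))\<^sup>2) \<le> 4 * ennreal ((cmod (f x))\<^sup>2)"
        by (simp add: ennreal_mult)
    qed
    also have "\<dots> < \<infinity>" using fin by (simp add: nn_integral_cmult energy_def ennreal_mult_less_top)
    finally show ?thesis by (simp add: L2_space_iff)
  qed
  ultimately show ?thesis using F(1) that by blast
qed

context algebra_exhaustion
begin

text \<open>
  Square-integrable functions are limits of simple functions, and each of the finitely many level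
  sets of a simple function is replaced by a set of the algebra. Keeping those sets inside members
  of the exhaustion is what puts the resulting step functions into \<open>scr_F_tilde\<close> later on.
\<close>

lemma step_funs_dense:
  assumes f: "f \<in> L2_space R"
  obtains u where "\<And>m. \<exists>n c s. u m = step_fun n c s \<and> (\<forall>i<n. s i \<in> G \<and> (\<exists>k. s i \<subseteq> W k))"
    "(\<lambda>m. energy R (\<lambda>x. u m x - f x)) \<longlonglongrightarrow> 0"
proof -
  have [measurable]: "f \<in> borel_measurable R" using f by (simp add: L2_space_iff)
  obtain F where F: "\<And>i. simple_function R (F i)" "\<And>i. F i \<in> L2_space R"
    "(\<lambda>i. energy R (\<lambda>x. F i x - f x)) \<longlonglongrightarrow> 0"
    by (rule L2_approx_by_simple_functions[OF f]) (rule that)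
  have "\<exists>u. (\<exists>n c s. u = step_fun n c s \<and> (\<forall>i<n. s i \<in> G \<and> (\<exists>k. s i \<subseteq> W k))) \<and>
     energy R (\<lambda>x. u x - F m x) < ennreal (1 / (real m + 1))" for m
  proof -
    obtain n c s where s: "\<And>i. i < n \<Longrightarrow> s i \<in> sets R" "\<And>i. i < n \<Longrightarrow> emeasure R (s i) < \<infinity>"
      "\<And>x. x \<in> space R \<Longrightarrow> F m x = step_fun n c s x"
      by (rule simple_function_L2_step_fun[OF F(1)[of m] F(2)[of m]]) (rule that)
    have "\<exists>C. (\<forall>j. C j \<in> G \<and> (\<exists>k. C j \<subseteq> W k)) \<and> (\<lambda>j. emeasure R (sym_diff (C j) (s i))) \<longlonglongrightarrow> 0"
      if "i < n" for i
      by (rule finite_measure_set_approximation[OF s(1)[OF that] s(2)[OF that]]) blast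
    then have "\<forall>i. \<exists>C. i < n \<longrightarrow> (\<forall>j. C j \<in> G \<and> (\<exists>k. C j \<subseteq> W k)) \<and>
        (\<lambda>j. emeasure R (sym_diff (C j) (s i))) \<longlonglongrightarrow> 0"
      by blast
    from choice[OF this] obtain C where C: "\<And>i j. i < n \<Longrightarrow> C i j \<in> G \<and> (\<exists>k. C i j \<subseteq> W k)"
      "\<And>i. i < n \<Longrightarrow> (\<lambda>j. emeasure R (sym_diff (C i j) (s i))) \<longlonglongrightarrow> 0"
      by blast
    have "(\<lambda>j. energy R (\<lambda>x. step_fun n c (\<lambda>i. C i j) x - step_fun n c s x)) \<longlonglongrightarrow> 0"
      by (rule step_fun_tendsto) (simp_all add: s(1) C G_sets)
    then have "\<forall>\<^sub>F j in sequentially. energy R (\<lambda>x. step_fun n c (\<lambda>i. C i j) x - step_fun n c s x)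
        < ennreal (1 / (real m + 1))"
      by (rule order_tendstoD) simp
    then obtain j where "energy R (\<lambda>x. step_fun n c (\<lambda>i. C i j) x - step_fun n c s x)
        < ennreal (1 / (real m + 1))"
      by (auto simp: eventually_sequentially)
    moreover have "energy R (\<lambda>x. step_fun n c (\<lambda>i. C i j) x - F m x)
       = energy R (\<lambda>x. step_fun n c (\<lambda>i. C i j) x - step_fun n c s x)"
      using s(3) by (intro energy_cong_AE AE_I2) auto
    ultimately show ?thesis
      using C(1) by (intro exI[of _ "step_fun n c (\<lambda>i. C i j)"] conjI exI[of _ n] exI[of _ c]
          exI[of _ "\<lambda>i. C i j"]) auto
  qed
  then obtain u where u: "\<And>m. \<exists>n c s. u m = step_fun n c s \<and> (\<forall>i<n. s i \<in> G \<and> (\<exists>k. s i \<subseteq> W k))"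
     "\<And>m. energy R (\<lambda>x. u m x - F m x) < ennreal (1 / (real m + 1))"
    by metis
  have [measurable]: "u m \<in> borel_measurable R" for m
    using u(1)[of m] G_sets step_fun_measurable by metis
  have [measurable]: "F m \<in> borel_measurable R" for m
    using F(2) by (simp add: L2_space_iff)
  have "(\<lambda>m. 1 / (real m + 1)) \<longlonglongrightarrow> 0"
    using LIMSEQ_inverse_real_of_nat by (simp add: inverse_eq_divide add.commute)
  then have "(\<lambda>m. ennreal (1 / (real m + 1))) \<longlonglongrightarrow> 0"
    using tendsto_ennrealI by fastforce
  then have "(\<lambda>m. 2 * ennreal (1 / (real m + 1)) + 2 * energy R (\<lambda>x. F m x - f x)) \<longlonglongrightarrow> 2 * 0 + 2 * 0"
    using F(3) by (intro tendsto_add ennreal_tendsto_cmult) auto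
  then have b: "(\<lambda>m. 2 * ennreal (1 / (real m + 1)) + 2 * energy R (\<lambda>x. F m x - f x)) \<longlonglongrightarrow> 0"
    by simp
  have le: "energy R (\<lambda>x. u m x - f x) \<le> 2 * ennreal (1 / (real m + 1)) + 2 * energy R (\<lambda>x. F m x - f x)" for m
  proof -
    have "energy R (\<lambda>x. u m x - f x) \<le> 2 * energy R (\<lambda>x. u m x - F m x) + 2 * energy R (\<lambda>x. F m x - f x)"
      by (rule energy_diff_triangle) auto
    also have "\<dots> \<le> 2 * ennreal (1 / (real m + 1)) + 2 * energy R (\<lambda>x. F m x - f x)"
      using u(2)[of m] by (intro add_mono mult_left_mono) auto
    finally show ?thesis .
  qed
  have lim: "(\<lambda>m. energy R (\<lambda>x. u m x - f x)) \<longlonglongrightarrow> 0"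
    by (rule tendsto_sandwich[OF _ always_eventually[OF allI[OF le]] tendsto_const b]) simp
  show ?thesis by (rule that[OF u(1) lim])
qed

end

text \<open>
  A set \<open>E\<close> must be approximated in both measures by the same set of the algebra. The supremum of
  the two measures, restricted to \<open>W\<close>, is finite and dominates both of them, so that one
  approximation with respect to this supremum serves for both.
\<close>

lemma inequality_extends_from_algebra:
  assumes alg: "algebra (space M) G" and gen: "sets M = sigma_sets (space M) G"
    and L[measurable_cong]: "sets L = sets M"
    and W: "W \<in> G" "emeasure M W < \<infinity>" "emeasure L W < \<infinity>"
    and T: "T < \<infinity>"
    and le: "\<And>C. C \<in> G \<Longrightarrow> C \<subseteq> W \<Longrightarrow> emeasure L C \<le> T * emeasure M C + e"
    and E[measurable]: "E \<in> sets M" and "E \<subseteq> W"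
  shows "emeasure L E \<le> T * emeasure M E + e"
proof -
  interpret G: algebra "space M" G by fact
  have sub: "C \<in> G \<Longrightarrow> C \<in> sets M" for C unfolding gen by auto
  note [measurable] = sub[OF W(1)]
  let ?M = "density M (indicator W)" and ?L = "density L (indicator W)"
  let ?R = "sup_measure' ?M ?L"
  have spL: "space L = space M" using L by (rule sets_eq_imp_space_eq)
  have sets_eq: "sets ?L = sets ?M" using L by simp
  have em: "emeasure ?M X = emeasure M (W \<inter> X)" "emeasure ?L X = emeasure L (W \<inter> X)"
    if [measurable]: "X \<in> sets M" for X
    by (simp_all add: emeasure_density nn_integral_indicator flip: indicator_inter_arith)
  have R_ge: "emeasure M (W \<inter> X) \<le> emeasure ?R X" "emeasure L (W \<inter> X) \<le> emeasure ?R X"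
    if X: "X \<in> sets M" for X
    using le_emeasure_sup_measure'1[OF sets_eq, of X] le_emeasure_sup_measure'2[OF sets_eq, of X]
    by (auto simp: em[OF X] X)
  have spR: "space ?R = space M" and setsR: "sets ?R = sets M"
    using sets_eq by simp_all
  interpret R: finite_measure ?R
  proof
    have "emeasure ?R (space M) = (SUP Y\<in>sets ?M. emeasure ?M (space M \<inter> Y) + emeasure ?L (space M \<inter> - Y))"
      by (rule emeasure_sup_measure'[OF sets_eq]) simp
    also have "\<dots> \<le> emeasure ?M (space M) + emeasure ?L (space M)"
      by (intro SUP_least add_mono emeasure_mono Int_lower1) (simp_all add: L)
    also have "\<dots> < \<infinity>" using W(2,3) sets.sets_into_space[OF sub[OF W(1)]]
      by (simp add: em Int_absorb2)
    finally show "emeasure ?R (space ?R) \<noteq> \<infinity>" using spR by simp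
  qed
  have bound: "emeasure L E \<le> T * emeasure M E + e + (T + 1) * ennreal r" if r: "0 < r" for r
  proof -
    have "\<exists>C\<in>G. measure ?R (sym_diff E C) < r"
      by (rule algebra_approximation) (use R.finite_measure_axioms alg gen spR setsR r E in simp_all)
    then obtain C where C: "C \<in> G" "measure ?R (sym_diff E C) < r" by blast
    note [measurable] = sub[OF C(1)]
    have R_small: "emeasure ?R (sym_diff E C) \<le> ennreal r"
      using C(2) by (simp add: R.emeasure_eq_measure ennreal_leI)
    have sd: "W \<inter> sym_diff E C = sym_diff E (C \<inter> W)" using \<open>E \<subseteq> W\<close> by auto
    have small: "emeasure M (sym_diff E (C \<inter> W)) \<le> ennreal r" "emeasure L (sym_diff E (C \<inter> W)) \<le> ennreal r"
      using R_ge[of "sym_diff E C"] R_small unfolding sd by (auto intro: order_trans)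
    have "emeasure L E \<le> emeasure L (C \<inter> W \<union> sym_diff E (C \<inter> W))"
      by (intro emeasure_mono) auto
    also have "\<dots> \<le> emeasure L (C \<inter> W) + emeasure L (sym_diff E (C \<inter> W))"
      by (intro emeasure_subadditive) auto
    also have "\<dots> \<le> (T * emeasure M (C \<inter> W) + e) + ennreal r"
      using C(1) W(1) small(2) by (intro add_mono le) auto
    also have "emeasure M (C \<inter> W) \<le> emeasure M (E \<union> sym_diff E (C \<inter> W))"
      by (intro emeasure_mono) auto
    also have "\<dots> \<le> emeasure M E + emeasure M (sym_diff E (C \<inter> W))"
      by (intro emeasure_subadditive) auto
    also have "\<dots> \<le> emeasure M E + ennreal r"
      using small(1) by (intro add_mono) auto
    also have "T * (emeasure M E + ennreal r) + e + ennreal r = T * emeasure M E + e + (T + 1) * ennreal r"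
      by (simp add: distrib_left distrib_right ac_simps)
    finally show ?thesis by (simp add: add_mono mult_left_mono)
  qed
  have "(\<lambda>j. 1 / (real j + 1)) \<longlonglongrightarrow> 0"
    using LIMSEQ_inverse_real_of_nat by (simp add: inverse_eq_divide add.commute)
  then have "(\<lambda>j. ennreal (1 / (real j + 1))) \<longlonglongrightarrow> 0"
    using tendsto_ennrealI by fastforce
  then have "(\<lambda>j. (T * emeasure M E + e) + (T + 1) * ennreal (1 / (real j + 1)))
    \<longlonglongrightarrow> (T * emeasure M E + e) + (T + 1) * 0"
    using T by (intro tendsto_add tendsto_const ennreal_tendsto_cmult) auto
  moreover have "emeasure L E \<le> (T * emeasure M E + e) + (T + 1) * ennreal (1 / (real j + 1))" for j
    by (rule bound) simp
  ultimately show ?thesis by (intro LIMSEQ_le_const) auto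
qed

section \<open>Cylinder sets\<close>

context target_space
begin

declare \<delta>_measurable[measurable]

lemma \<delta>_in_space: "x \<in> space M \<Longrightarrow> \<delta> n x \<in> space (N n)"
  using \<delta>_measurable by (rule measurable_space)

lemma cylinder_lift_level:
  assumes "k \<le> m"
  shows "\<delta> k -` \<sigma> \<inter> space M = \<delta> m -` (d k m -` \<sigma> \<inter> space (N m)) \<inter> space M"
  using \<delta>_comp[OF assms] \<delta>_in_space by auto

text \<open>
  Finitely many cylinder sets are preimages of sets in one and the same \<open>N L\<close>: the level of a
  cylinder set can be raised, and a sum of levels is an upper bound for them.
\<close>

lemma cylinder_common_level:
  fixes n :: nat
  assumes "\<And>i. i < n \<Longrightarrow> s i \<in> cylinder_sets N M \<delta>"
  obtains L \<tau> where "\<And>i. i < n \<Longrightarrow> \<tau> i \<in> sets (N L)" "\<And>i. i < n \<Longrightarrow> s i = \<delta> L -` \<tau> i \<inter> space M"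
proof -
  have "\<forall>i. \<exists>k \<sigma>. i < n \<longrightarrow> \<sigma> \<in> sets (N k) \<and> s i = \<delta> k -` \<sigma> \<inter> space M"
    using assms unfolding cylinder_sets_def by blast
  then obtain k \<sigma> where k: "\<And>i. i < n \<Longrightarrow> \<sigma> i \<in> sets (N (k i))"
    "\<And>i. i < n \<Longrightarrow> s i = \<delta> (k i) -` \<sigma> i \<inter> space M"
    by metis
  define L where "L = (\<Sum>i<n. k i)"
  have kL: "k i \<le> L" if "i < n" for i
    unfolding L_def using that by (intro member_le_sum) auto
  show ?thesis
  proof (rule that)
    fix i assume i: "i < n"
    show "d (k i) L -` \<sigma> i \<inter> space (N L) \<in> sets (N L)"
      using d_measurable[OF kL[OF i]] k(1)[OF i] by (rule measurable_sets)
    show "s i = \<delta> L -` (d (k i) L -` \<sigma> i \<inter> space (N L)) \<inter> space M"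
      using k(2)[OF i] cylinder_lift_level[OF kL[OF i]] by simp
  qed
qed

lemma cylinderI: "\<sigma> \<in> sets (N k) \<Longrightarrow> \<delta> k -` \<sigma> \<inter> space M \<in> cylinder_sets N M \<delta>"
  unfolding cylinder_sets_def by blast

lemma cylinder_sets_algebra: "algebra (space M) (cylinder_sets N M \<delta>)"
  unfolding algebra_iff_Int
proof (intro conjI ballI)
  show "cylinder_sets N M \<delta> \<subseteq> Pow (space M)" unfolding cylinder_sets_def by auto
  show "{} \<in> cylinder_sets N M \<delta>" using cylinderI[of "{}" 0] by simp
  fix a assume a: "a \<in> cylinder_sets N M \<delta>"
  then obtain k \<sigma> where "\<sigma> \<in> sets (N k)" "a = \<delta> k -` \<sigma> \<inter> space M"
    unfolding cylinder_sets_def by auto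
  moreover from this have "space M - a = \<delta> k -` (space (N k) - \<sigma>) \<inter> space M"
    using \<delta>_in_space by auto
  ultimately show "space M - a \<in> cylinder_sets N M \<delta>" using cylinderI by auto
  fix b assume b: "b \<in> cylinder_sets N M \<delta>"
  let ?s = "\<lambda>i::nat. if i = 0 then a else b"
  obtain L \<tau> where "\<And>i. i < 2 \<Longrightarrow> \<tau> i \<in> sets (N L)" "\<And>i. i < 2 \<Longrightarrow> ?s i = \<delta> L -` \<tau> i \<inter> space M"
    by (rule cylinder_common_level[of 2 ?s]) (use a b in auto)
  from this(1)[of 0] this(1)[of 1] this(2)[of 0] this(2)[of 1]
  have "\<tau> 0 \<inter> \<tau> 1 \<in> sets (N L)" "a \<inter> b = \<delta> L -` (\<tau> 0 \<inter> \<tau> 1) \<inter> space M"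
    by auto
  then show "a \<inter> b \<in> cylinder_sets N M \<delta>" using cylinderI by metis
qed

lemma cylinder_in_sets: "C \<in> cylinder_sets N M \<delta> \<Longrightarrow> C \<in> sets M"
  unfolding sets_generated by auto

end

context isometric_target_space
begin

text \<open>
  The isometry property, applied to the indicator function of \<open>\<sigma>\<close>, compares the two measures of
  \<open>\<sigma>\<close>.
\<close>

lemma emeasure_distr_\<delta>_finite:
  assumes [measurable]: "\<sigma> \<in> sets (N k)" and fin: "emeasure (N k) \<sigma> < \<infinity>"
  shows "emeasure (distr M (N k) (\<delta> k)) \<sigma> = emeasure (N k) \<sigma>"
proof -
  let ?f = "indicator \<sigma> :: 'b \<Rightarrow> complex"
  have en: "energy K ?f = emeasure K \<sigma>" if "sets K = sets (N k)" for K
    using energy_indicator_diff[of \<sigma> K "{}"] that by simp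
  have f: "?f \<in> L2_space (N k)" using fin by (simp add: L2_space_iff en)
  have m: "?f \<circ> \<delta> k \<in> borel_measurable M" by measurable
  have eq: "energy M (?f \<circ> \<delta> k) = emeasure (distr M (N k) (\<delta> k)) \<sigma>"
    by (subst energy_distr[symmetric, where K = "N k"]) (auto simp: en)
  have "energy M (?f \<circ> \<delta> k) < \<infinity>" "L2_norm M (?f \<circ> \<delta> k) = L2_norm (N k) ?f"
    using \<Delta>_isometry[OF f] by (auto simp: L2_space_iff)
  then have "enn2real (emeasure (distr M (N k) (\<delta> k)) \<sigma>) = enn2real (emeasure (N k) \<sigma>)"
    "emeasure (distr M (N k) (\<delta> k)) \<sigma> < \<infinity>"
    using m unfolding eq by (auto simp: L2_norm_energy en eq)
  then show ?thesis using fin by (metis ennreal_enn2real infinity_ennreal_def)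
qed

text \<open>
  All statements about the spaces \<open>N k\<close> can hence be pulled back to \<open>M\<close> without loss.
\<close>

lemma distr_\<delta>: "distr M (N k) (\<delta> k) = N k"
proof (rule measure_eqI)
  interpret sigma_finite_measure "N k" by (rule N_sigma_finite)
  fix \<sigma> assume "\<sigma> \<in> sets (distr M (N k) (\<delta> k))"
  then have \<sigma>[measurable]: "\<sigma> \<in> sets (N k)" by simp
  obtain F :: "nat \<Rightarrow> 'b set" where F: "range F \<subseteq> sets (N k)" "(\<Union>i. F i) = space (N k)"
    "\<And>i. emeasure (N k) (F i) \<noteq> \<infinity>" "incseq F"
    by (rule sigma_finite_incseq) (rule that)
  have [measurable]: "F i \<in> sets (N k)" for i using F(1) by auto
  have F_inc: "incseq (\<lambda>i. \<sigma> \<inter> F i)" using F(4) by (auto simp: incseq_def)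
  have F_un: "(\<Union>i. \<sigma> \<inter> F i) = \<sigma>" using F(2) sets.sets_into_space[OF \<sigma>] by auto
  have "emeasure (distr M (N k) (\<delta> k)) (\<sigma> \<inter> F i) = emeasure (N k) (\<sigma> \<inter> F i)" for i
  proof (rule emeasure_distr_\<delta>_finite)
    have "emeasure (N k) (\<sigma> \<inter> F i) \<le> emeasure (N k) (F i)" by (intro emeasure_mono) auto
    then show "emeasure (N k) (\<sigma> \<inter> F i) < \<infinity>" using F(3)[of i] by (auto simp: less_top top_unique)
  qed auto
  then have eq: "(SUP i. emeasure (distr M (N k) (\<delta> k)) (\<sigma> \<inter> F i)) = (SUP i. emeasure (N k) (\<sigma> \<inter> F i))"
    by presburger
  have SUP_eq: "(SUP i. emeasure K (\<sigma> \<inter> F i)) = emeasure K \<sigma>" if K: "sets K = sets (N k)" for K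
  proof -
    have "range (\<lambda>i. \<sigma> \<inter> F i) \<subseteq> sets K" unfolding K using F(1) \<sigma> by auto
    from SUP_emeasure_incseq[OF this F_inc] show ?thesis unfolding F_un .
  qed
  show "emeasure (distr M (N k) (\<delta> k)) \<sigma> = emeasure (N k) \<sigma>"
    using eq unfolding SUP_eq[OF refl] SUP_eq[OF sets_distr] .
qed simp

lemma emeasure_cylinder:
  "\<sigma> \<in> sets (N k) \<Longrightarrow> emeasure M (\<delta> k -` \<sigma> \<inter> space M) = emeasure (N k) \<sigma>"
  using emeasure_distr[OF \<delta>_measurable, of \<sigma> k] distr_\<delta> by simp

lemma energy_\<delta>:
  "f \<in> borel_measurable (N k) \<Longrightarrow> energy M (f \<circ> \<delta> k) = energy (N k) f"
  using energy_distr[OF \<delta>_measurable, of f k] distr_\<delta> by simp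

lemma L2_\<delta>_iff:
  "f \<in> borel_measurable (N k) \<Longrightarrow> f \<circ> \<delta> k \<in> L2_space M \<longleftrightarrow> f \<in> L2_space (N k)"
  by (simp add: L2_space_iff energy_\<delta> measurable_comp[OF \<delta>_measurable])

lemma AE_\<delta>_iff:
  assumes "{x \<in> space (N k). P x} \<in> sets (N k)"
  shows "(AE x in M. P (\<delta> k x)) \<longleftrightarrow> (AE x in N k. P x)"
  using AE_distr_iff[OF \<delta>_measurable assms] unfolding distr_\<delta> ..

lemma cylinder_exhaustion:
  obtains Z where "\<And>j. Z j \<in> cylinder_sets N M \<delta>" "incseq Z" "(\<Union>j. Z j) = space M"
    "\<And>j. emeasure M (Z j) < \<infinity>"
proof -
  interpret sigma_finite_measure "N 0" by (rule N_sigma_finite)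
  obtain F :: "nat \<Rightarrow> 'b set" where F: "range F \<subseteq> sets (N 0)" "(\<Union>i. F i) = space (N 0)"
    "\<And>i. emeasure (N 0) (F i) \<noteq> \<infinity>" "incseq F"
    by (rule sigma_finite_incseq) (rule that)
  have Fs: "F i \<in> sets (N 0)" for i using F(1) by auto
  show ?thesis
  proof (rule that)
    show "\<delta> 0 -` F j \<inter> space M \<in> cylinder_sets N M \<delta>" for j using Fs by (rule cylinderI)
    show "incseq (\<lambda>j. \<delta> 0 -` F j \<inter> space M)" using F(4) by (auto simp: incseq_def)
    show "(\<Union>j. \<delta> 0 -` F j \<inter> space M) = space M" using F(2) \<delta>_in_space[of _ 0] by (simp flip: F(2)) blast
    show "emeasure M (\<delta> 0 -` F j \<inter> space M) < \<infinity>" for j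
      using F(3)[of j] Fs by (simp add: emeasure_cylinder less_top)
  qed
qed

lemma M_sigma_finite: "sigma_finite_measure M"
proof
  obtain Z where Z: "\<And>j. Z j \<in> cylinder_sets N M \<delta>" "incseq Z" "(\<Union>j. Z j) = space M"
    "\<And>j. emeasure M (Z j) < \<infinity>" by (rule cylinder_exhaustion) (rule that)
  show "\<exists>A. countable A \<and> A \<subseteq> sets M \<and> \<Union> A = space M \<and> (\<forall>a\<in>A. emeasure M a \<noteq> \<infinity>)"
    using Z(3,4) cylinder_in_sets[OF Z(1)] by (intro exI[of _ "range Z"]) (auto simp: less_top)
qed

end

section \<open>Convergence of the transported measures\<close>

text \<open>
  The case of infinite limit is separate, because the difference of two infinite extended numbers
  is not informative: there the sets themselves have infinite measure as soon as the symmetric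
  difference has finite measure.
\<close>

lemma emeasure_tendsto_of_sym_diff:
  assumes [measurable]: "\<And>n. E n \<in> sets M" "B \<in> sets M"
    and lim: "(\<lambda>n. emeasure M (sym_diff (E n) B)) \<longlonglongrightarrow> 0"
  shows "(\<lambda>n. emeasure M (E n)) \<longlonglongrightarrow> emeasure M B"
proof -
  let ?s = "\<lambda>n. emeasure M (sym_diff (E n) B)"
  have 1: "emeasure M B \<le> ?s n + emeasure M (E n)" for n
  proof -
    have "emeasure M B \<le> emeasure M (sym_diff (E n) B \<union> E n)"
      by (intro emeasure_mono) auto
    also have "\<dots> \<le> ?s n + emeasure M (E n)"
      by (intro emeasure_subadditive) auto
    finally show ?thesis .
  qed
  have 2: "emeasure M (E n) \<le> emeasure M B + ?s n" for n
  proof -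
    have "emeasure M (E n) \<le> emeasure M (B \<union> sym_diff (E n) B)"
      by (intro emeasure_mono) auto
    also have "\<dots> \<le> emeasure M B + ?s n"
      by (intro emeasure_subadditive) auto
    finally show ?thesis .
  qed
  have small: "\<forall>\<^sub>F n in sequentially. ?s n < 1" using lim by (rule order_tendstoD) simp
  show ?thesis
  proof (cases "emeasure M B = top")
    case True
    have "\<forall>\<^sub>F n in sequentially. emeasure M B = emeasure M (E n)"
      using small
    proof eventually_elim
      case (elim n)
      then have "?s n < top" by (rule less_trans) simp
      then show ?case using 1[of n] True by (auto simp: top_unique)
    qed
    then show ?thesis by (rule Lim_transform_eventually[OF tendsto_const])
  next
    case False
    have low: "emeasure M B - ?s n \<le> emeasure M (E n)" for n
      using 1[of n] False by (simp add: ennreal_minus_le_iff)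
    have lim1: "(\<lambda>n. emeasure M B - ?s n) \<longlonglongrightarrow> emeasure M B"
      using tendsto_diff_ennreal[OF tendsto_const lim False] by simp
    have lim2: "(\<lambda>n. emeasure M B + ?s n) \<longlonglongrightarrow> emeasure M B"
      using tendsto_add[OF tendsto_const lim, of "emeasure M B"] by simp
    show ?thesis
      by (rule tendsto_sandwich[OF always_eventually[OF allI[OF low]]
            always_eventually[OF allI[OF 2]] lim1 lim2])
  qed
qed

locale approximated_transformation = isometric_target_space N d M \<delta>
  for N :: "nat \<Rightarrow> 'b measure" and d :: "nat \<Rightarrow> nat \<Rightarrow> 'b \<Rightarrow> 'b"
    and M :: "'a measure" and \<delta> :: "nat \<Rightarrow> 'a \<Rightarrow> 'b" +
  fixes An :: "nat \<Rightarrow> 'b \<Rightarrow> 'b" and A :: "'a \<Rightarrow> 'a"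
  assumes An_measurable: "An n \<in> measurable (N n) (N n)"
    and A_measurable: "A \<in> measurable M M"
    and An_tendsto: "\<sigma> \<in> sets (N k) \<Longrightarrow>
      (\<lambda>n. emeasure M (sym_diff ((d k n \<circ> An n \<circ> \<delta> n) -` \<sigma> \<inter> space M)
                                ((\<delta> k \<circ> A) -` \<sigma> \<inter> space M))) \<longlonglongrightarrow> 0"
begin

declare An_measurable[measurable] A_measurable[measurable]

lemma preimage_in_sets:
  assumes "k \<le> n" "\<sigma> \<in> sets (N k)"
  shows "(d k n \<circ> An n \<circ> \<delta> n) -` \<sigma> \<inter> space M \<in> sets M"
proof -
  have "d k n \<circ> An n \<circ> \<delta> n \<in> measurable M (N k)"
    by (intro measurable_comp[OF \<delta>_measurable] measurable_comp[OF An_measurable] d_measurable assms)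
  then show ?thesis using assms(2) by (rule measurable_sets)
qed

lemma limit_preimage_in_sets:
  assumes "\<sigma> \<in> sets (N k)"
  shows "(\<delta> k \<circ> A) -` \<sigma> \<inter> space M \<in> sets M"
  using measurable_comp[OF A_measurable \<delta>_measurable] assms by (rule measurable_sets)

lemma emeasure_preimage_tendsto:
  assumes \<sigma>: "\<sigma> \<in> sets (N k)"
  shows "(\<lambda>n. emeasure M ((d k n \<circ> An n \<circ> \<delta> n) -` \<sigma> \<inter> space M))
    \<longlonglongrightarrow> emeasure M ((\<delta> k \<circ> A) -` \<sigma> \<inter> space M)"
proof (rule LIMSEQ_offset)
  (* for n < k the map d k n is arbitrary, and its preimages need not be measurable *)
  show "(\<lambda>n. emeasure M ((d k (n + k) \<circ> An (n + k) \<circ> \<delta> (n + k)) -` \<sigma> \<inter> space M))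
    \<longlonglongrightarrow> emeasure M ((\<delta> k \<circ> A) -` \<sigma> \<inter> space M)"
    using preimage_in_sets \<sigma> limit_preimage_in_sets LIMSEQ_ignore_initial_segment[OF An_tendsto[OF \<sigma>], of k]
    by (intro emeasure_tendsto_of_sym_diff) auto
qed

text \<open>
  The measures that converge in \<open>emeasure_preimage_tendsto\<close> are those of the transported system.
\<close>

lemma emeasure_preimage_level:
  assumes "k \<le> n" and \<sigma>: "\<sigma> \<in> sets (N k)"
  shows "emeasure M ((d k n \<circ> An n \<circ> \<delta> n) -` \<sigma> \<inter> space M)
    = emeasure (distr (N n) (N n) (An n)) (d k n -` \<sigma> \<inter> space (N n))"
proof -
  have d: "d k n -` \<sigma> \<inter> space (N n) \<in> sets (N n)"
    using d_measurable[OF assms(1)] \<sigma> by (rule measurable_sets)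
  have "(d k n \<circ> An n \<circ> \<delta> n) -` \<sigma> \<inter> space M
     = \<delta> n -` (An n -` (d k n -` \<sigma> \<inter> space (N n)) \<inter> space (N n)) \<inter> space M"
    using \<delta>_in_space measurable_space[OF An_measurable] by auto
  then show ?thesis
    by (simp only: emeasure_cylinder[OF measurable_sets[OF An_measurable d]]
        emeasure_distr[OF An_measurable d])
qed

lemma transported_target_space:
  "target_space (\<lambda>n. distr (N n) (N n) (An n)) d (distr M M A) \<delta>"
proof (intro target_space.intro projective_system.intro target_space_axioms.intro)
  fix n m :: nat assume nm: "n \<le> m"
  show "d n m \<in> measurable (distr (N m) (N m) (An m)) (distr (N n) (N n) (An n))"
    using d_measurable[OF nm] by simp
  show "d n m ` space (distr (N m) (N m) (An m)) = space (distr (N n) (N n) (An n))"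
    using d_surj[OF nm] by simp
  show "d n k x = (d n m \<circ> d m k) x" if "m \<le> k" "x \<in> space (distr (N k) (N k) (An k))" for k :: nat and x
    using d_comp[OF nm] that by simp
  show "\<delta> n x = (d n m \<circ> \<delta> m) x" if "x \<in> space (distr M M A)" for x
    using \<delta>_comp[OF nm] that by simp
next
  fix n :: nat
  show "d n n x = x" if "x \<in> space (distr (N n) (N n) (An n))" for x
    using d_id that by simp
  show "\<delta> n \<in> measurable (distr M M A) (distr (N n) (N n) (An n))" by simp
  show "\<delta> n ` space (distr M M A) = space (distr (N n) (N n) (An n))"
    using \<delta>_surj by simp
  fix \<sigma> assume "\<sigma> \<in> sets (distr (N n) (N n) (An n))"
  then have \<sigma>: "\<sigma> \<in> sets (N n)" by simp
  have lim: "emeasure (distr M M A) (\<delta> n -` \<sigma> \<inter> space (distr M M A)) = emeasure M ((\<delta> n \<circ> A) -` \<sigma> \<inter> space M)"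
  proof -
    have "(\<delta> n \<circ> A) -` \<sigma> \<inter> space M = A -` (\<delta> n -` \<sigma> \<inter> space M) \<inter> space M"
      using measurable_space[OF A_measurable] by auto
    then show ?thesis using measurable_sets[OF \<delta>_measurable \<sigma>] by (simp add: emeasure_distr)
  qed
  show "(\<lambda>m. emeasure (distr (N m) (N m) (An m)) (d n m -` \<sigma> \<inter> space (distr (N m) (N m) (An m))))
     \<longlonglongrightarrow> emeasure (distr M M A) (\<delta> n -` \<sigma> \<inter> space (distr M M A))"
    unfolding lim
  proof (rule Lim_transform_eventually[OF emeasure_preimage_tendsto[OF \<sigma>]])
    show "\<forall>\<^sub>F m in sequentially. emeasure M ((d n m \<circ> An m \<circ> \<delta> m) -` \<sigma> \<inter> space M)
       = emeasure (distr (N m) (N m) (An m)) (d n m -` \<sigma> \<inter> space (distr (N m) (N m) (An m)))"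
      using eventually_ge_at_top[of n] by eventually_elim (simp add: emeasure_preimage_level \<sigma>)
  qed
next
  have "cylinder_sets (\<lambda>n. distr (N n) (N n) (An n)) (distr M M A) \<delta> = cylinder_sets N M \<delta>"
    by (simp add: cylinder_sets_def)
  then show "sets (distr M M A) = sigma_sets (space (distr M M A))
      (cylinder_sets (\<lambda>n. distr (N n) (N n) (An n)) (distr M M A) \<delta>)"
    using sets_generated by simp
qed

end

section \<open>Uniform integrability and nonsingularity of the limit transformation\<close>

text \<open>
  This is the easy half of the criterion of de la Vallee Poussin. Superlinearity of \<open>G\<close> gives
  \<open>t \<le> T + G t / K\<close> for all \<open>t \<ge> 0\<close>, where \<open>K\<close> is as large as desired and \<open>T\<close> depends on \<open>K\<close>
  only. Integration over \<open>E\<close> leaves \<open>T\<close> times the measure of \<open>E\<close> and a small constant.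
\<close>

lemma superlinear_imp_uniform_integrability:
  fixes f :: "nat \<Rightarrow> 'a \<Rightarrow> real"
  assumes G: "G \<in> scr_M (\<lambda>n. M) f"
    and f[measurable]: "\<And>n. f n \<in> borel_measurable M" and f_nonneg: "\<And>n x. 0 \<le> f n x"
    and e: "(0::real) < e"
  obtains T :: real where
    "\<And>n E. E \<in> sets M \<Longrightarrow> (\<integral>\<^sup>+x. ennreal (f n x) * indicator E x \<partial>M) \<le> ennreal T * emeasure M E + ennreal e"
proof -
  from G have G_nonneg: "\<And>t. 0 \<le> t \<Longrightarrow> 0 \<le> G t" and G_mono: "mono_on {0..} G"
    and G_lim: "filterlim (\<lambda>t. G t / t) at_top at_top"
    and G_int: "(SUP n. \<integral>\<^sup>+ x. ennreal (G (norm (f n x))) \<partial>M) < \<infinity>"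
    unfolding scr_M_def by auto
  (* G is monotone, hence Borel, on the half line only, so it is first extended to a monotone function *)
  have "mono (\<lambda>t. G (max 0 t))"
    by (rule monoI, rule mono_onD[OF G_mono]) auto
  then have "(\<lambda>t. G (max 0 t)) \<in> borel_measurable borel" by (rule borel_measurable_mono)
  then have "(\<lambda>x. G (max 0 (f n x))) \<in> borel_measurable M" for n
    by (rule measurable_compose[OF f])
  then have Gf[measurable]: "(\<lambda>x. G (f n x)) \<in> borel_measurable M" for n
    using f_nonneg by (simp add: max_absorb2)
  define s where "s = enn2real (SUP n. \<integral>\<^sup>+ x. ennreal (G (norm (f n x))) \<partial>M)"
  have s: "0 \<le> s" "(SUP n. \<integral>\<^sup>+ x. ennreal (G (norm (f n x))) \<partial>M) = ennreal s"
    unfolding s_def using ennreal_enn2real[OF G_int[unfolded infinity_ennreal_def]] by simp_all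
  have s_upper: "(\<integral>\<^sup>+ x. ennreal (G (f n x)) \<partial>M) \<le> ennreal s" for n
    using SUP_upper[of n UNIV "\<lambda>n. \<integral>\<^sup>+ x. ennreal (G (norm (f n x))) \<partial>M"] f_nonneg
    unfolding s(2) by simp
  (* s + 1 keeps K positive when s = 0, while s / K stays below e *)
  define K where "K = (s + 1) / e"
  have K: "0 < K" "1 / K * s \<le> e"
    using s(1) e unfolding K_def by (auto simp: field_simps)
  have "\<forall>\<^sub>F t in at_top. K \<le> G t / t"
    using G_lim unfolding filterlim_at_top by blast
  then obtain T0 where T0: "\<And>t. T0 \<le> t \<Longrightarrow> K \<le> G t / t"
    unfolding eventually_at_top_linorder by auto
  define T where "T = max T0 1"
  have T: "0 < T" "\<And>t. T \<le> t \<Longrightarrow> K \<le> G t / t"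
    using T0 unfolding T_def by auto
  have pointwise: "ennreal (f n x) \<le> ennreal T + ennreal (1 / K) * ennreal (G (f n x))" for n x
  proof -
    have "f n x \<le> T + 1 / K * G (f n x)"
    proof (cases "f n x \<le> T")
      case True
      then show ?thesis using G_nonneg[OF f_nonneg[of n x]] K(1) by (simp add: add_increasing2)
    next
      case False
      then have "K * f n x \<le> G (f n x)" using T by (simp add: field_simps) (smt (verit) divide_right_mono le_divide_eq mult.commute)
      then show ?thesis using K(1) T(1) by (simp add: field_simps) (smt (verit) mult_pos_pos)
    qed
    then have "ennreal (f n x) \<le> ennreal (T + 1 / K * G (f n x))" by (rule ennreal_leI)
    also have "\<dots> = ennreal T + ennreal (1 / K) * ennreal (G (f n x))"
      using T(1) K(1) G_nonneg[OF f_nonneg[of n x]] by (subst ennreal_plus, simp, simp, subst ennreal_mult) simp_all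
    finally show ?thesis .
  qed
  show ?thesis
  proof (rule that)
    fix n E assume [measurable]: "E \<in> sets M"
    have "(\<integral>\<^sup>+x. ennreal (f n x) * indicator E x \<partial>M)
       \<le> (\<integral>\<^sup>+x. ennreal T * indicator E x + ennreal (1 / K) * ennreal (G (f n x)) \<partial>M)"
      using pointwise by (intro nn_integral_mono) (auto simp: indicator_def)
    also have "\<dots> = ennreal T * emeasure M E + ennreal (1 / K) * (\<integral>\<^sup>+x. ennreal (G (f n x)) \<partial>M)"
      by (simp add: nn_integral_add nn_integral_cmult)
    also have "\<dots> \<le> ennreal T * emeasure M E + ennreal (1 / K) * ennreal s"
      using s_upper by (intro add_left_mono mult_left_mono) auto
    also have "\<dots> \<le> ennreal T * emeasure M E + ennreal e"
      using K s(1) by (intro add_left_mono) (simp add: ennreal_leI flip: ennreal_mult)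
    finally show "(\<integral>\<^sup>+x. ennreal (f n x) * indicator E x \<partial>M) \<le> ennreal T * emeasure M E + ennreal e" .
  qed
qed

text \<open>
  The hypotheses under which the limit transformation is nonsingular. The family
  \<open>indicator (Y k) * (h_deriv (N n) (An n) \<circ> \<delta> n)\<close>, for fixed \<open>k\<close> and varying \<open>n\<close>, is uniformly
  integrable.
\<close>

locale locally_integrable_approximation = approximated_transformation N d M \<delta> An A
  for N :: "nat \<Rightarrow> 'b measure" and d :: "nat \<Rightarrow> nat \<Rightarrow> 'b \<Rightarrow> 'b"
    and M :: "'a measure" and \<delta> :: "nat \<Rightarrow> 'a \<Rightarrow> 'b"
    and An :: "nat \<Rightarrow> 'b \<Rightarrow> 'b" and A :: "'a \<Rightarrow> 'a" +
  fixes Y :: "nat \<Rightarrow> 'a set"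
  assumes An_nonsingular: "nonsingular (N n) (An n)"
    and Y_cylinder: "Y k \<in> cylinder_sets N M \<delta>"
    and Y_inc: "incseq Y"
    and Y_exhausts: "(\<Union>k. Y k) = space M"
    and h_integrable: "(\<integral>\<^sup>+ x. indicator (Y k) x * h_deriv (N n) (An n) (\<delta> n x) \<partial>M) < \<infinity>"
    and h_superlinear: "scr_M (\<lambda>n. M) (\<lambda>n x. enn2real (indicator (Y k) x * h_deriv (N n) (An n) (\<delta> n x))) \<noteq> {}"
begin

lemma Y_sets[measurable]: "Y k \<in> sets M"
  using Y_cylinder by (rule cylinder_in_sets)

lemma h_measurable[measurable]: "h_deriv (N n) (An n) \<in> borel_measurable (N n)"
  unfolding h_deriv_def by simp

lemma density_h: "density (N n) (h_deriv (N n) (An n)) = distr (N n) (N n) (An n)"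
proof -
  interpret sigma_finite_measure "N n" by (rule N_sigma_finite)
  show ?thesis
    using An_nonsingular[of n] unfolding h_deriv_def nonsingular_def by (intro density_RN_deriv) auto
qed

text \<open>
  On cylinder sets, from their level on, the function \<open>h_deriv (N n) (An n) \<circ> \<delta> n\<close> is a density of
  the transported measure of level \<open>n\<close>.
\<close>

lemma emeasure_preimage_eq_integral:
  assumes kn: "k \<le> n" and \<sigma>: "\<sigma> \<in> sets (N k)"
  shows "emeasure M ((d k n \<circ> An n \<circ> \<delta> n) -` \<sigma> \<inter> space M)
    = (\<integral>\<^sup>+x. h_deriv (N n) (An n) (\<delta> n x) * indicator (\<delta> k -` \<sigma> \<inter> space M) x \<partial>M)"
proof -
  let ?B = "d k n -` \<sigma> \<inter> space (N n)"
  have B[measurable]: "?B \<in> sets (N n)"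
    using d_measurable[OF kn] \<sigma> by (rule measurable_sets)
  have "emeasure M ((d k n \<circ> An n \<circ> \<delta> n) -` \<sigma> \<inter> space M) = emeasure (density (N n) (h_deriv (N n) (An n))) ?B"
    unfolding density_h by (rule emeasure_preimage_level[OF kn \<sigma>])
  also have "\<dots> = (\<integral>\<^sup>+y. h_deriv (N n) (An n) y * indicator ?B y \<partial>N n)"
    by (rule emeasure_density) measurable
  also have "\<dots> = (\<integral>\<^sup>+y. h_deriv (N n) (An n) y * indicator ?B y \<partial>distr M (N n) (\<delta> n))"
    by (simp only: distr_\<delta>)
  also have "\<dots> = (\<integral>\<^sup>+x. h_deriv (N n) (An n) (\<delta> n x) * indicator ?B (\<delta> n x) \<partial>M)"
    by (rule nn_integral_distr) measurable
  also have "\<dots> = (\<integral>\<^sup>+x. h_deriv (N n) (An n) (\<delta> n x) * indicator (\<delta> k -` \<sigma> \<inter> space M) x \<partial>M)"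
    using cylinder_lift_level[OF kn, of \<sigma>] by (intro nn_integral_cong) (auto simp: indicator_def)
  finally show ?thesis .
qed

lemma limit_preimage_eq: "(\<delta> k \<circ> A) -` \<sigma> \<inter> space M = A -` (\<delta> k -` \<sigma> \<inter> space M) \<inter> space M"
  using measurable_space[OF A_measurable] by auto

text \<open>
  A preimage of \<open>Y k\<close> of late level has finite measure because the density is integrable over
  \<open>Y k\<close>, and the limit preimage differs from it by a set of measure less than \<open>1\<close>.
\<close>

lemma image_Y_finite: "emeasure (distr M M A) (Y k) < \<infinity>"
proof -
  obtain j \<sigma> where \<sigma>: "\<sigma> \<in> sets (N j)" and Yk: "Y k = \<delta> j -` \<sigma> \<inter> space M"
    using Y_cylinder[of k] unfolding cylinder_sets_def by auto
  let ?E = "\<lambda>n. (d j n \<circ> An n \<circ> \<delta> n) -` \<sigma> \<inter> space M" and ?B = "(\<delta> j \<circ> A) -` \<sigma> \<inter> space M"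
  have "\<forall>\<^sub>F n in sequentially. emeasure M (sym_diff (?E n) ?B) < 1"
    using An_tendsto[OF \<sigma>] by (rule order_tendstoD) simp
  then have "\<forall>\<^sub>F n in sequentially. j \<le> n \<and> emeasure M (sym_diff (?E n) ?B) < 1"
    using eventually_ge_at_top by (rule eventually_conj[rotated])
  then obtain n where n: "j \<le> n" "emeasure M (sym_diff (?E n) ?B) < 1"
    using eventually_happens'[OF sequentially_bot] by blast
  have E: "?E n \<in> sets M" and B: "?B \<in> sets M"
    using preimage_in_sets[OF n(1) \<sigma>] limit_preimage_in_sets[OF \<sigma>] by auto
  have "emeasure M (?E n) < \<infinity>"
    using h_integrable[of k n] unfolding emeasure_preimage_eq_integral[OF n(1) \<sigma>] Yk
    by (simp add: mult.commute)
  then have fin: "emeasure M (?E n) + emeasure M (sym_diff (?E n) ?B) < \<infinity>"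
    using n(2) less_trans[OF n(2), of top] by simp
  have "emeasure M ?B \<le> emeasure M (?E n \<union> sym_diff (?E n) ?B)"
    using E B by (intro emeasure_mono) auto
  also have "\<dots> \<le> emeasure M (?E n) + emeasure M (sym_diff (?E n) ?B)"
    using E B by (intro emeasure_subadditive) auto
  also note fin
  finally show ?thesis
    unfolding limit_preimage_eq Yk[symmetric] by (simp add: emeasure_distr)
qed

text \<open>
  The constants \<open>T\<close> and \<open>e\<close> do not depend on the level, so the estimate for the densities
  passes to the limit measure on cylinder sets.
\<close>

lemma cylinder_bound:
  assumes "(0::real) < e"
  obtains T :: real where "\<And>C. C \<in> cylinder_sets N M \<delta> \<Longrightarrow> C \<subseteq> Y k \<Longrightarrow>
    emeasure (distr M M A) C \<le> ennreal T * emeasure M C + ennreal e"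
proof -
  let ?f = "\<lambda>n x. enn2real (indicator (Y k) x * h_deriv (N n) (An n) (\<delta> n x))"
  have f_meas: "?f n \<in> borel_measurable M" for n by measurable
  obtain G where G: "G \<in> scr_M (\<lambda>n. M) ?f" using h_superlinear[of k] by blast
  obtain T :: real where T: "\<And>n E. E \<in> sets M \<Longrightarrow>
      (\<integral>\<^sup>+x. ennreal (?f n x) * indicator E x \<partial>M) \<le> ennreal T * emeasure M E + ennreal e"
    by (rule superlinear_imp_uniform_integrability[OF G f_meas enn2real_nonneg assms]) (rule that)
  show ?thesis
  proof (rule that)
    fix C assume C: "C \<in> cylinder_sets N M \<delta>" "C \<subseteq> Y k"
    have [measurable]: "C \<in> sets M" using C(1) by (rule cylinder_in_sets)
    from C(1) obtain j \<sigma> where \<sigma>: "\<sigma> \<in> sets (N j)" and Cj: "C = \<delta> j -` \<sigma> \<inter> space M"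
      unfolding cylinder_sets_def by auto
    have "emeasure M ((d j n \<circ> An n \<circ> \<delta> n) -` \<sigma> \<inter> space M) \<le> ennreal T * emeasure M C + ennreal e"
      if "j \<le> n" for n
    proof -
      have "AE x in M. indicator (Y k) x * h_deriv (N n) (An n) (\<delta> n x) \<noteq> \<infinity>"
        using h_integrable[of k n] by (intro nn_integral_PInf_AE) auto
      then have "AE x in M. h_deriv (N n) (An n) (\<delta> n x) * indicator C x = ennreal (?f n x) * indicator C x"
        by eventually_elim (use C(2) in \<open>auto simp: indicator_def less_top\<close>)
      then have "(\<integral>\<^sup>+x. h_deriv (N n) (An n) (\<delta> n x) * indicator C x \<partial>M)
         = (\<integral>\<^sup>+x. ennreal (?f n x) * indicator C x \<partial>M)"
        by (rule nn_integral_cong_AE)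
      also have "\<dots> \<le> ennreal T * emeasure M C + ennreal e" by (rule T) simp
      finally show ?thesis
        unfolding emeasure_preimage_eq_integral[OF that \<sigma>] Cj[symmetric] .
    qed
    then have "emeasure M ((\<delta> j \<circ> A) -` \<sigma> \<inter> space M) \<le> ennreal T * emeasure M C + ennreal e"
      using LIMSEQ_le_const2[OF emeasure_preimage_tendsto[OF \<sigma>]] by blast
    then show "emeasure (distr M M A) C \<le> ennreal T * emeasure M C + ennreal e"
      unfolding limit_preimage_eq Cj[symmetric] by (simp add: emeasure_distr)
  qed
qed

text \<open>
  The sets \<open>Y k\<close> may have infinite measure; intersecting them with an exhaustion by cylinder sets
  of finite measure repairs this.
\<close>

lemma common_exhaustion:
  obtains W where "\<And>k. W k \<in> cylinder_sets N M \<delta>" "incseq W" "(\<Union>k. W k) = space M"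
    "\<And>k. W k \<subseteq> Y k" "\<And>k. emeasure M (W k) < \<infinity>" "\<And>k. emeasure (distr M M A) (W k) < \<infinity>"
proof -
  interpret cyl: algebra "space M" "cylinder_sets N M \<delta>" by (rule cylinder_sets_algebra)
  obtain Z where Z: "\<And>j. Z j \<in> cylinder_sets N M \<delta>" "incseq Z" "(\<Union>j. Z j) = space M"
    "\<And>j. emeasure M (Z j) < \<infinity>" by (rule cylinder_exhaustion) (rule that)
  note [measurable] = cylinder_in_sets[OF Z(1)]
  show ?thesis
  proof (rule that)
    show "Y k \<inter> Z k \<in> cylinder_sets N M \<delta>" for k using Y_cylinder Z(1) by (rule cyl.Int)
    show "incseq (\<lambda>k. Y k \<inter> Z k)" by (intro monoI Int_mono incseqD[OF Y_inc] incseqD[OF Z(2)])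
    show "(\<Union>k. Y k \<inter> Z k) = space M"
    proof (intro equalityI subsetI)
      fix x assume "x \<in> space M"
      then have "x \<in> (\<Union>k. Y k)" "x \<in> (\<Union>k. Z k)" using Y_exhausts Z(3) by simp_all
      then obtain i j where "x \<in> Y i" "x \<in> Z j" by blast
      then have "x \<in> Y (max i j)" "x \<in> Z (max i j)"
        using incseqD[OF Y_inc max.cobounded1[of i j]] incseqD[OF Z(2) max.cobounded2[of j i]] by auto
      then show "x \<in> (\<Union>k. Y k \<inter> Z k)" by blast
    qed (use Y_exhausts in auto)
    show "Y k \<inter> Z k \<subseteq> Y k" for k by simp
    show "emeasure M (Y k \<inter> Z k) < \<infinity>" for k
      using emeasure_mono[of "Y k \<inter> Z k" "Z k" M] Z(4)[of k] by (auto intro: le_less_trans)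
    show "emeasure (distr M M A) (Y k \<inter> Z k) < \<infinity>" for k
      using emeasure_mono[of "Y k \<inter> Z k" "Y k" "distr M M A"] image_Y_finite[of k]
      by (auto intro: le_less_trans)
  qed
qed

text \<open>
  The estimate of \<open>cylinder_bound\<close> extends to all measurable subsets of a member of the common
  exhaustion. For a null set it says that the image measure is at most \<open>e\<close>, for every
  \<open>e\<close>.
\<close>

lemma A_nonsingular: "nonsingular M A"
  unfolding nonsingular_def absolutely_continuous_def
proof
  fix E assume "E \<in> null_sets M"
  then have E[measurable]: "E \<in> sets M" and E0: "emeasure M E = 0" by auto
  obtain W where W: "\<And>k. W k \<in> cylinder_sets N M \<delta>" "incseq W" "(\<Union>k. W k) = space M"
    "\<And>k. W k \<subseteq> Y k" "\<And>k. emeasure M (W k) < \<infinity>" "\<And>k. emeasure (distr M M A) (W k) < \<infinity>"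
    by (rule common_exhaustion) (rule that)
  note [measurable] = cylinder_in_sets[OF W(1)]
  have null: "emeasure (distr M M A) (E \<inter> W k) = 0" for k
  proof -
    have "emeasure (distr M M A) (E \<inter> W k) \<le> 0 + ennreal e" if e: "0 < e" for e
    proof -
      obtain T :: real where T: "\<And>C. C \<in> cylinder_sets N M \<delta> \<Longrightarrow> C \<subseteq> Y k \<Longrightarrow>
          emeasure (distr M M A) C \<le> ennreal T * emeasure M C + ennreal e"
        by (rule cylinder_bound[OF e]) (rule that)
      have "emeasure (distr M M A) (E \<inter> W k) \<le> ennreal T * emeasure M (E \<inter> W k) + ennreal e"
      proof (rule inequality_extends_from_algebra[OF cylinder_sets_algebra sets_generated _ W(1,5,6)])
        show "emeasure (distr M M A) C \<le> ennreal T * emeasure M C + ennreal e"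
          if "C \<in> cylinder_sets N M \<delta>" "C \<subseteq> W k" for C
          using that W(4)[of k] by (intro T) auto
      qed auto
      moreover have "emeasure M (E \<inter> W k) \<le> emeasure M E" by (intro emeasure_mono) auto
      ultimately show ?thesis using E0 by simp
    qed
    then have "emeasure (distr M M A) (E \<inter> W k) \<le> 0" by (rule ennreal_le_epsilon) 
    then show ?thesis by simp
  qed
  have "(\<Union>k. E \<inter> W k) = E" using W(3) sets.sets_into_space[OF E] by auto
  moreover have "(\<Union>k. E \<inter> W k) \<in> null_sets (distr M M A)"
    using null by (intro null_sets_UN) auto
  ultimately show "E \<in> null_sets (distr M M A)" by simp
qed

lemma AE_compose_A:
  assumes "AE x in M. P x"
  shows "AE x in M. P (A x)"
proof -
  have "AE x in distr M M A. P x"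
    by (rule absolutely_continuous_AE[OF sets_distr A_nonsingular[unfolded nonsingular_def] assms])
  then show ?thesis by (rule AE_distrD[OF A_measurable])
qed

lemma AE_compose_An:
  assumes "AE x in N n. P x"
  shows "AE x in N n. P (An n x)"
proof -
  have "AE x in distr (N n) (N n) (An n). P x"
    by (rule absolutely_continuous_AE[OF sets_distr An_nonsingular[unfolded nonsingular_def] assms])
  then show ?thesis by (rule AE_distrD[OF An_measurable])
qed

end

section \<open>Composition operators are closed\<close>

lemma L2_tendsto_AE_subseq:
  assumes u: "\<And>n. u n \<in> L2_space M" and f: "f \<in> L2_space M" and lim: "L2_tendsto M u f"
  obtains r where "strict_mono r" "AE x in M. (\<lambda>n. u (r n) x) \<longlonglongrightarrow> f x"
proof -
  have int: "integrable M (\<lambda>x. (cmod (u n x - f x))\<^sup>2)" for n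
    using L2_space_diff[OF u f, of n] by (simp add: L2_space_def)
  have "(\<lambda>n. (sqrt (LINT x|M. (cmod (u n x - f x))\<^sup>2))\<^sup>2) \<longlonglongrightarrow> 0\<^sup>2"
    using lim unfolding L2_tendsto_def L2_norm_def by (rule tendsto_power)
  then have "(\<lambda>n. LINT x|M. norm ((cmod (u n x - f x))\<^sup>2)) \<longlonglongrightarrow> 0" by simp
  then obtain r where r: "strict_mono r" "AE x in M. (\<lambda>n. (cmod (u (r n) x - f x))\<^sup>2) \<longlonglongrightarrow> 0"
    using tendsto_L1_AE_subseq[where u = "\<lambda>n x. (cmod (u n x - f x))\<^sup>2", OF int] by blast
  have "AE x in M. (\<lambda>n. u (r n) x) \<longlonglongrightarrow> f x"
    using r(2)
  proof eventually_elim
    case (elim x)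
    from tendsto_real_sqrt[OF elim] have "(\<lambda>n. u (r n) x - f x) \<longlonglongrightarrow> 0"
      by (simp add: tendsto_norm_zero_iff)
    then show ?case by (simp add: LIM_zero_iff)
  qed
  with r(1) show ?thesis by (rule that)
qed

text \<open>
  Pass to a common subsequence along which \<open>u n\<close> and \<open>u n \<circ> A\<close> converge almost everywhere.
  Nonsingularity carries the first convergence over to \<open>u n \<circ> A\<close>, where it identifies the limit.
\<close>

lemma closed_comp_op:
  assumes A: "A \<in> measurable M M" and ns: "nonsingular M A"
  shows "closed_op M (comp_op M A)"
  unfolding closed_op_def
proof
  fix p assume "p \<in> op_closure M (comp_op M A)"
  then obtain f g u v where p: "p = (f, g)" and f: "f \<in> L2_space M" and g: "g \<in> L2_space M"
    and uv: "\<And>n. (u n, v n) \<in> comp_op M A" and lim: "L2_tendsto M u f" "L2_tendsto M v g"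
    unfolding op_closure_def by blast
  have u: "u n \<in> L2_space M" and v: "v n \<in> L2_space M" and eq: "AE x in M. v n x = u n (A x)" for n
    using uv[of n] unfolding comp_op_def by auto
  obtain r where r: "strict_mono r" "AE x in M. (\<lambda>n. u (r n) x) \<longlonglongrightarrow> f x"
    by (rule L2_tendsto_AE_subseq[OF u f lim(1)])
  have "L2_tendsto M (\<lambda>n. v (r n)) g"
    using LIMSEQ_subseq_LIMSEQ[OF lim(2)[unfolded L2_tendsto_def] r(1)]
    unfolding L2_tendsto_def by (simp add: comp_def)
  from L2_tendsto_AE_subseq[OF v g this] obtain q
    where q: "strict_mono q" "AE x in M. (\<lambda>n. v (r (q n)) x) \<longlonglongrightarrow> g x" .
  have "AE x in distr M M A. (\<lambda>n. u (r n) x) \<longlonglongrightarrow> f x"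
    by (rule absolutely_continuous_AE[OF sets_distr ns[unfolded nonsingular_def] r(2)])
  then have fA: "AE x in M. (\<lambda>n. u (r n) (A x)) \<longlonglongrightarrow> f (A x)" by (rule AE_distrD[OF A])
  have "AE x in M. \<forall>n. v n x = u n (A x)" using eq by (simp add: AE_all_countable)
  with fA q(2) have gf: "AE x in M. g x = f (A x)"
  proof eventually_elim
    case (elim x)
    from LIMSEQ_subseq_LIMSEQ[OF elim(1) q(1)] elim(3)
    have "(\<lambda>n. v (r (q n)) x) \<longlonglongrightarrow> f (A x)" by (simp add: comp_def)
    then show ?case using elim(2) LIMSEQ_unique by blast
  qed
  have fA_meas: "f \<circ> A \<in> borel_measurable M"
    using f measurable_comp[OF A] by (auto simp: L2_space_iff)
  have "AE x in M. g x = (f \<circ> A) x" using gf by simp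
  then have "f \<circ> A \<in> L2_space M" using g fA_meas by (rule L2_space_cong_AE)
  then show "p \<in> comp_op M A" using gf f g unfolding p comp_op_def by simp
qed

lemma op_closure_mono: "T \<subseteq> T' \<Longrightarrow> op_closure M T \<subseteq> op_closure M T'"
  unfolding op_closure_def by blast

section \<open>The limit operator on step functions over cylinder sets\<close>

lemma ae_saturateI: "f \<in> S \<Longrightarrow> f \<in> borel_measurable M \<Longrightarrow> f \<in> ae_saturate M S"
  unfolding ae_saturate_def by auto

context isometric_target_space
begin

lemma indicator_in_\<Delta>_range:
  assumes C: "C \<in> cylinder_sets N M \<delta>" and fin: "emeasure M C < \<infinity>"
  shows "indicator C \<in> \<Delta>_range N M \<delta>"
proof -
  obtain k \<sigma> where \<sigma>: "\<sigma> \<in> sets (N k)" and Ck: "C = \<delta> k -` \<sigma> \<inter> space M"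
    using C unfolding cylinder_sets_def by auto
  have "energy (N k) (indicator \<sigma>) = emeasure (N k) \<sigma>"
    using energy_indicator_diff[of \<sigma> "N k" "{}"] \<sigma> by simp
  then have "indicator \<sigma> \<in> L2_space (N k)"
    using fin \<sigma> unfolding Ck by (simp add: L2_space_iff emeasure_cylinder)
  moreover have "AE x in M. indicator C x = (indicator \<sigma> \<circ> \<delta> k) x"
    unfolding Ck by (auto simp: indicator_def)
  moreover have "indicator C \<in> borel_measurable M"
    using cylinder_in_sets[OF C] by simp
  ultimately show ?thesis unfolding \<Delta>_range_def ae_saturate_def by blast
qed

text \<open>
  If \<open>indicator s\<close> is almost everywhere \<open>f \<circ> \<delta> k\<close>, then \<open>f \<circ> \<delta> k\<close> takes the values
  \<open>0\<close> and \<open>1\<close> almost everywhere, and the preimage of \<open>1\<close> is the cylinder set sought. Hence,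
  up to null sets, \<open>scr_F\<close> consists of the step functions over cylinder sets of finite measure.
\<close>

lemma indicator_in_\<Delta>_range_imp_cylinder:
  assumes "indicator s \<in> \<Delta>_range N M \<delta>"
  obtains C where "C \<in> cylinder_sets N M \<delta>" "AE x in M. x \<in> C \<longleftrightarrow> x \<in> s"
proof -
  obtain k f where f: "f \<in> L2_space (N k)" and eq: "AE x in M. indicator s x = f (\<delta> k x)"
    using assms unfolding \<Delta>_range_def ae_saturate_def by auto
  let ?\<sigma> = "f -` {1} \<inter> space (N k)"
  have "?\<sigma> \<in> sets (N k)"
    using f by (intro measurable_sets[of _ _ borel]) (auto simp: L2_space_iff)
  then have "\<delta> k -` ?\<sigma> \<inter> space M \<in> cylinder_sets N M \<delta>" by (rule cylinderI)
  moreover have "AE x in M. x \<in> \<delta> k -` ?\<sigma> \<inter> space M \<longleftrightarrow> x \<in> s"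
    using eq AE_space
  proof eventually_elim
    case (elim x)
    then show ?case using \<delta>_in_space[of x k] by (auto simp: indicator_def split: if_splits)
  qed
  ultimately show ?thesis by (rule that)
qed

lemma scr_F_iff:
  "f \<in> scr_F N M \<delta> \<longleftrightarrow> f \<in> borel_measurable M \<and> (\<exists>n c s.
     (\<forall>i<n. s i \<in> sets M \<and> emeasure M (s i) < \<infinity> \<and> indicator (s i) \<in> \<Delta>_range N M \<delta>) \<and>
     (AE x in M. f x = step_fun n c s x))"
proof -
  have "scr_F N M \<delta> = ae_saturate M {step_fun n c s |n c s.
     \<forall>i<n. s i \<in> sets M \<and> emeasure M (s i) < \<infinity> \<and> indicator (s i) \<in> \<Delta>_range N M \<delta>}"
    by (simp only: scr_F_def step_fun_def)
  then show ?thesis by (auto simp: ae_saturate_def)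
qed

lemma scr_F_step_fun:
  assumes "f \<in> scr_F N M \<delta>"
  obtains n c s where "\<And>i. i < n \<Longrightarrow> s i \<in> cylinder_sets N M \<delta>"
    "\<And>i. i < n \<Longrightarrow> emeasure M (s i) < \<infinity>" "AE x in M. f x = step_fun n c s x"
proof -
  obtain n c s where s: "\<forall>i<n. s i \<in> sets M \<and> emeasure M (s i) < \<infinity> \<and> indicator (s i) \<in> \<Delta>_range N M \<delta>"
    and eq: "AE x in M. f x = step_fun n c s x"
    using assms unfolding scr_F_iff by blast
  have "\<forall>i. \<exists>C. i < n \<longrightarrow> C \<in> cylinder_sets N M \<delta> \<and> (AE x in M. x \<in> C \<longleftrightarrow> x \<in> s i)"
    using s indicator_in_\<Delta>_range_imp_cylinder by metis
  from choice[OF this] obtain C where C: "\<And>i. i < n \<Longrightarrow> C i \<in> cylinder_sets N M \<delta>"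
    "\<And>i. i < n \<Longrightarrow> AE x in M. x \<in> C i \<longleftrightarrow> x \<in> s i" by blast
  show ?thesis
  proof (rule that[of n C c])
    show "emeasure M (C i) < \<infinity>" if "i < n" for i
    proof -
      have "emeasure M (C i) = emeasure M (s i)"
        using C[OF that] s that cylinder_in_sets by (intro emeasure_eq_AE) auto
      then show ?thesis using s that by simp
    qed
    have "AE x in M. \<forall>i<n. x \<in> C i \<longleftrightarrow> x \<in> s i"
      using C(2) by (simp add: AE_all_countable)
    with eq show "AE x in M. f x = step_fun n c C x"
    proof eventually_elim
      case (elim x)
      then show ?case unfolding step_fun_def by (auto simp: indicator_def intro!: sum.cong)
    qed
  qed (use C(1) in auto)
qed

lemma step_fun_in_scr_F:
  assumes "\<And>i. i < n \<Longrightarrow> s i \<in> cylinder_sets N M \<delta>" "\<And>i. i < n \<Longrightarrow> emeasure M (s i) < \<infinity>"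
  shows "step_fun n c s \<in> scr_F N M \<delta>"
  unfolding scr_F_iff
proof (intro conjI exI)
  show "step_fun n c s \<in> borel_measurable M"
    using assms(1) cylinder_in_sets by (intro step_fun_measurable) auto
  show "\<forall>i<n. s i \<in> sets M \<and> emeasure M (s i) < \<infinity> \<and> indicator (s i) \<in> \<Delta>_range N M \<delta>"
    using assms indicator_in_\<Delta>_range cylinder_in_sets by blast
  show "AE x in M. step_fun n c s x = step_fun n c s x" by simp
qed

end

context locally_integrable_approximation
begin

abbreviation "lim_An \<equiv> lim_op N d M \<delta> (\<lambda>n. comp_op (N n) (An n))"

abbreviation "F_tilde \<equiv> scr_F_tilde N M \<delta> Y"

text \<open>
  Multiplication by \<open>indicator (Y k)\<close> intersects the sets of a step function with a cylinder set;
  then all of them are brought to a common level.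
\<close>

lemma F_tilde_step_fun:
  assumes "u \<in> F_tilde"
  obtains k n c L \<tau> where "\<And>i. i < n \<Longrightarrow> \<tau> i \<in> sets (N L)"
    "\<And>i. i < n \<Longrightarrow> \<delta> L -` \<tau> i \<inter> space M \<subseteq> Y k" "\<And>i. i < n \<Longrightarrow> emeasure (N L) (\<tau> i) < \<infinity>"
    "AE x in M. u x = step_fun n c \<tau> (\<delta> L x)"
proof -
  interpret cyl: algebra "space M" "cylinder_sets N M \<delta>" by (rule cylinder_sets_algebra)
  obtain k f where f: "f \<in> scr_F N M \<delta>" and uf: "AE x in M. u x = indicator (Y k) x * f x"
    using assms unfolding scr_F_tilde_def ae_saturate_def by auto
  obtain n c s where s: "\<And>i. i < n \<Longrightarrow> s i \<in> cylinder_sets N M \<delta>"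
    "\<And>i. i < n \<Longrightarrow> emeasure M (s i) < \<infinity>" "AE x in M. f x = step_fun n c s x"
    by (rule scr_F_step_fun[OF f]) (rule that)
  have sY: "s i \<inter> Y k \<in> cylinder_sets N M \<delta>" if "i < n" for i
    using s(1)[OF that] Y_cylinder by (rule cyl.Int)
  obtain L \<tau> where \<tau>: "\<And>i. i < n \<Longrightarrow> \<tau> i \<in> sets (N L)"
    "\<And>i. i < n \<Longrightarrow> s i \<inter> Y k = \<delta> L -` \<tau> i \<inter> space M"
    by (rule cylinder_common_level[of n "\<lambda>i. s i \<inter> Y k"]) (rule sY, assumption, rule that)
  show ?thesis
  proof (rule that)
    show "\<tau> i \<in> sets (N L)" if "i < n" for i using \<tau>(1) that .
    show "\<delta> L -` \<tau> i \<inter> space M \<subseteq> Y k" if "i < n" for i using \<tau>(2)[OF that] by blast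
    show "emeasure (N L) (\<tau> i) < \<infinity>" if i: "i < n" for i
    proof -
      have "emeasure (N L) (\<tau> i) = emeasure M (s i \<inter> Y k)"
        using \<tau>(2)[OF i] emeasure_cylinder[OF \<tau>(1)[OF i]] by simp
      also have "\<dots> \<le> emeasure M (s i)"
        using cylinder_in_sets[OF s(1)[OF i]] by (intro emeasure_mono) auto
      finally show ?thesis using s(2)[OF i] by (rule le_less_trans)
    qed
    show "AE x in M. u x = step_fun n c \<tau> (\<delta> L x)"
      using uf s(3) AE_space
    proof eventually_elim
      case (elim x)
      have "step_fun n c \<tau> (\<delta> L x) = step_fun n c (\<lambda>i. s i \<inter> Y k) x"
        unfolding step_fun_vimage using elim(3) \<tau>(2) by (intro step_fun_cong) auto
      also have "\<dots> = indicator (Y k) x * step_fun n c s x"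
        by (cases "x \<in> Y k") (auto simp: step_fun_def indicator_def intro!: sum.cong sum.neutral)
      finally show ?case using elim by simp
    qed
  qed
qed

text \<open>
  For \<open>u = f \<circ> \<delta> L\<close> with a step function \<open>f\<close>, the functions whose limit defines the operator are
  the step functions with the same coefficients over the preimages under \<open>d L m \<circ> An m \<circ> \<delta> m\<close>.
  These preimages converge, in measure of the symmetric difference, to those under \<open>\<delta> L \<circ> A\<close>, so
  the limit is \<open>u \<circ> A\<close>. They have finite measure for all large \<open>m\<close> because their limits do, and
  this puts \<open>f \<circ> d L m\<close> into the domain.
\<close>

lemma cylinder_step_fun_in_lim:
  assumes \<tau>: "\<And>i. i < n \<Longrightarrow> \<tau> i \<in> sets (N L)"
    and fin: "\<And>i. i < n \<Longrightarrow> emeasure (N L) (\<tau> i) < \<infinity>"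
      "\<And>i. i < n \<Longrightarrow> emeasure (distr M M A) (\<delta> L -` \<tau> i \<inter> space M) < \<infinity>"
    and u: "u \<in> borel_measurable M" "AE x in M. u x = step_fun n c \<tau> (\<delta> L x)"
    and v: "v \<in> borel_measurable M" "AE x in M. v x = u (A x)"
  shows "u \<in> L2_space M" "u \<circ> A \<in> L2_space M" "(u, v) \<in> lim_An"
proof -
  let ?f = "step_fun n c \<tau>"
  let ?E = "\<lambda>m i. (d L m \<circ> An m \<circ> \<delta> m) -` \<tau> i \<inter> space M"
  let ?B = "\<lambda>i. (\<delta> L \<circ> A) -` \<tau> i \<inter> space M"
  let ?g = "\<lambda>m. ?f \<circ> d L m \<circ> An m"
  have f: "?f \<in> L2_space (N L)" using \<tau> fin(1) by (rule step_fun_L2)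
  then have f_meas[measurable]: "?f \<in> borel_measurable (N L)" by (simp add: L2_space_iff)
  have f\<delta>: "?f \<circ> \<delta> L \<in> L2_space M" using f L2_\<delta>_iff[OF f_meas] by simp
  show u_L2: "u \<in> L2_space M"
    using u(2) by (intro L2_space_cong_AE[OF _ f\<delta> u(1)]) (auto elim: AE_mp)
  have B: "?B i \<in> sets M" "emeasure M (?B i) < \<infinity>" if "i < n" for i
    using limit_preimage_in_sets[OF \<tau>[OF that]] fin(2)[OF that] measurable_sets[OF \<delta>_measurable \<tau>[OF that]]
    unfolding limit_preimage_eq by (simp_all add: emeasure_distr)
  have stepB: "step_fun n c ?B \<in> L2_space M" using B by (rule step_fun_L2)
  have uA_eq: "AE x in M. step_fun n c ?B x = (u \<circ> A) x"
    using AE_compose_A[OF u(2)] AE_space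
  proof eventually_elim
    case (elim x)
    have "step_fun n c \<tau> (\<delta> L (A x)) = step_fun n c ?B x"
      unfolding step_fun_vimage[of n c \<tau> "\<lambda>x. \<delta> L (A x)" x]
      using elim(2) by (intro step_fun_cong) auto
    then show ?case using elim(1) by simp
  qed
  then show uA: "u \<circ> A \<in> L2_space M"
    using measurable_comp[OF A_measurable u(1)] by (rule L2_space_cong_AE[OF _ stepB])
  have v_eq: "AE x in M. v x = step_fun n c ?B x" using v(2) uA_eq by eventually_elim simp
  then have v_L2: "v \<in> L2_space M"
    using v(1) by (intro L2_space_cong_AE[OF _ stepB]) (auto elim: AE_mp)
  have "\<forall>\<^sub>F m in sequentially. \<forall>i\<in>{..<n}. emeasure M (?E m i) < \<infinity>"
    using order_tendstoD(2)[OF emeasure_preimage_tendsto[OF \<tau>] B(2)]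
    by (intro eventually_ball_finite) auto
  then have ev: "\<forall>\<^sub>F m in sequentially. L \<le> m \<and> (\<forall>i\<in>{..<n}. emeasure M (?E m i) < \<infinity>)"
    using eventually_ge_at_top by (rule eventually_conj[rotated])
  then obtain m0 where m0: "\<And>m. m0 \<le> m \<Longrightarrow> L \<le> m"
    "\<And>m i. m0 \<le> m \<Longrightarrow> i < n \<Longrightarrow> emeasure M (?E m i) < \<infinity>"
    unfolding eventually_sequentially by auto
  have E: "?E m i \<in> sets M" if "m0 \<le> m" "i < n" for m i
    using preimage_in_sets[OF m0(1) \<tau>] that by blast
  have g\<delta>: "(?g m \<circ> \<delta> m) x = step_fun n c (?E m) x" if "x \<in> space M" for m x
    unfolding comp_def step_fun_vimage[of n c \<tau> "\<lambda>x. d L m (An m (\<delta> m x))" x]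
    using that by (intro step_fun_cong) auto
  have g_meas: "?g m \<in> borel_measurable (N m)" and fd_meas: "?f \<circ> d L m \<in> borel_measurable (N m)"
    if "m0 \<le> m" for m
    using measurable_comp[OF d_measurable[OF m0(1)[OF that]] f_meas]
      measurable_comp[OF An_measurable measurable_comp[OF d_measurable[OF m0(1)[OF that]] f_meas]]
    by (simp_all add: comp_assoc)
  have g\<delta>_L2: "?g m \<circ> \<delta> m \<in> L2_space M" if "m0 \<le> m" for m
  proof (rule L2_space_cong_AE)
    show "step_fun n c (?E m) \<in> L2_space M" using E m0(2) that by (intro step_fun_L2) auto
    show "AE x in M. step_fun n c (?E m) x = (?g m \<circ> \<delta> m) x" using g\<delta> by (intro AE_I2) simp
    show "?g m \<circ> \<delta> m \<in> borel_measurable M" using \<delta>_measurable g_meas[OF that] by (rule measurable_comp)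
  qed
  have graph: "(?f \<circ> d L m, ?g m) \<in> comp_op (N m) (An m)" if m: "m0 \<le> m" for m
  proof -
    have "?f \<circ> d L m \<circ> \<delta> m \<in> L2_space M"
    proof (rule L2_space_cong_AE[OF _ f\<delta>])
      show "AE x in M. (?f \<circ> \<delta> L) x = (?f \<circ> d L m \<circ> \<delta> m) x"
        using \<delta>_comp[OF m0(1)[OF m]] by (intro AE_I2) simp
      show "?f \<circ> d L m \<circ> \<delta> m \<in> borel_measurable M" using \<delta>_measurable fd_meas[OF m] by (rule measurable_comp)
    qed
    then have "?f \<circ> d L m \<in> L2_space (N m)" using L2_\<delta>_iff[OF fd_meas[OF m]] by simp
    moreover have "?g m \<in> L2_space (N m)" using L2_\<delta>_iff[OF g_meas[OF m]] g\<delta>_L2[OF m] by simp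
    ultimately show ?thesis unfolding comp_op_def by simp
  qed
  have "(\<lambda>m. energy M (\<lambda>x. step_fun n c (?E m) x - step_fun n c ?B x)) \<longlonglongrightarrow> 0"
  proof (rule step_fun_tendsto)
    show "\<forall>\<^sub>F m in sequentially. \<forall>i<n. ?E m i \<in> sets M"
      using eventually_ge_at_top[of m0] by eventually_elim (use E in blast)
  qed (use B(1) An_tendsto \<tau> in auto)
  moreover have "energy M (\<lambda>x. step_fun n c (?E m) x - step_fun n c ?B x)
     = energy M (\<lambda>x. (?g m \<circ> \<delta> m) x - v x)" for m
  proof (rule energy_cong_AE)
    show "AE x in M. step_fun n c (?E m) x - step_fun n c ?B x = (?g m \<circ> \<delta> m) x - v x"
      using v_eq AE_space by eventually_elim (simp only: g\<delta>)
  qed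
  ultimately have lim: "(\<lambda>m. energy M (\<lambda>x. (?g m \<circ> \<delta> m) x - v x)) \<longlonglongrightarrow> 0" by simp
  have ev_L2: "\<forall>\<^sub>F m in sequentially. ?g m \<circ> \<delta> m \<in> L2_space M"
    using eventually_ge_at_top[of m0] by eventually_elim (rule g\<delta>_L2)
  have "L2_tendsto M (\<lambda>m. ?g m \<circ> \<delta> m) v"
    using lim unfolding L2_tendsto_iff_energy[OF ev_L2 v_L2] .
  moreover have "AE x in M. u x = (?f \<circ> \<delta> L) x" using u(2) by simp
  ultimately show "(u, v) \<in> lim_An"
    unfolding lim_op_def using u_L2 v_L2
    by (intro CollectI case_prodI conjI exI[of _ L] bexI[OF _ f] exI[of _ ?g] exI[of _ m0] allI impI)
      (use graph m0(1) in auto)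
qed

text \<open>
  The definition of the limit operator admits every representation of \<open>u\<close> as some \<open>f \<circ> \<delta> k\<close>.
  Two of them agree almost everywhere once they are lifted to a common level \<open>m\<close>, since \<open>\<delta> m\<close>
  transports \<open>M\<close> to \<open>N m\<close>, and nonsingularity of \<open>An m\<close> preserves this.
\<close>

lemma lim_An_unique:
  assumes "(u, v) \<in> lim_An" "(u, v') \<in> lim_An"
  shows "AE x in M. v x = v' x"
proof -
  obtain k f g m0 where 1: "f \<in> L2_space (N k)" "AE x in M. u x = (f \<circ> \<delta> k) x" "k \<le> m0"
    "\<And>m. m0 \<le> m \<Longrightarrow> (f \<circ> d k m, g m) \<in> comp_op (N m) (An m)"
    "L2_tendsto M (\<lambda>m. g m \<circ> \<delta> m) v" "v \<in> L2_space M"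
    using assms(1) unfolding lim_op_def by auto
  obtain k' f' g' m0' where 2: "f' \<in> L2_space (N k')" "AE x in M. u x = (f' \<circ> \<delta> k') x" "k' \<le> m0'"
    "\<And>m. m0' \<le> m \<Longrightarrow> (f' \<circ> d k' m, g' m) \<in> comp_op (N m) (An m)"
    "L2_tendsto M (\<lambda>m. g' m \<circ> \<delta> m) v'" "v' \<in> L2_space M"
    using assms(2) unfolding lim_op_def by auto
  have key: "(AE x in M. (g m \<circ> \<delta> m) x = (g' m \<circ> \<delta> m) x) \<and> g m \<circ> \<delta> m \<in> L2_space M \<and> g' m \<circ> \<delta> m \<in> L2_space M"
    if m: "m0 \<le> m" "m0' \<le> m" for m
  proof -
    let ?p = "f \<circ> d k m" and ?p' = "f' \<circ> d k' m"
    have [measurable]: "?p \<in> borel_measurable (N m)" "?p' \<in> borel_measurable (N m)"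
      using 1(4)[OF m(1)] 2(4)[OF m(2)] by (auto simp: comp_op_def L2_space_iff)
    have "AE x in M. ?p (\<delta> m x) = ?p' (\<delta> m x)"
      using 1(2) 2(2) AE_space
    proof eventually_elim
      case (elim x)
      then show ?case using \<delta>_comp[of k m x] \<delta>_comp[of k' m x] 1(3) 2(3) m by simp
    qed
    then have "AE y in N m. ?p y = ?p' y" by (subst (asm) AE_\<delta>_iff) measurable
    from AE_compose_An[OF this] have "AE y in N m. g m y = g' m y"
      using 1(4)[OF m(1)] 2(4)[OF m(2)] unfolding comp_op_def by auto
    then have "AE y in distr M (N m) (\<delta> m). g m y = g' m y" by (simp only: distr_\<delta>)
    then have "AE x in M. g m (\<delta> m x) = g' m (\<delta> m x)" by (rule AE_distrD[OF \<delta>_measurable])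
    moreover have "g m \<in> L2_space (N m)" "g' m \<in> L2_space (N m)"
      using 1(4)[OF m(1)] 2(4)[OF m(2)] unfolding comp_op_def by auto
    ultimately show ?thesis using L2_\<delta>_iff by (auto simp: L2_space_iff)
  qed
  have ev: "\<forall>\<^sub>F m in sequentially. (AE x in M. (g m \<circ> \<delta> m) x = (g' m \<circ> \<delta> m) x) \<and> g m \<circ> \<delta> m \<in> L2_space M \<and> g' m \<circ> \<delta> m \<in> L2_space M"
    using eventually_ge_at_top[of m0] eventually_ge_at_top[of m0'] by eventually_elim (rule key)
  then have ev': "\<forall>\<^sub>F m in sequentially. AE x in M. (g m \<circ> \<delta> m) x = (g' m \<circ> \<delta> m) x"
    "\<forall>\<^sub>F m in sequentially. g m \<circ> \<delta> m \<in> L2_space M" "\<forall>\<^sub>F m in sequentially. g' m \<circ> \<delta> m \<in> L2_space M"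
    by (auto elim: eventually_mono)
  have "L2_tendsto M (\<lambda>m. g' m \<circ> \<delta> m) v"
    using L2_tendsto_cong_AE[OF ev' _ 1(6) 1(6)] 1(5) by simp
  then show ?thesis by (rule L2_tendsto_unique[OF ev'(3) 1(6) 2(6) _ 2(5)])
qed

lemma F_tilde_lim:
  assumes "u \<in> F_tilde"
  shows "u \<in> L2_space M" "u \<circ> A \<in> L2_space M"
    "\<And>v. v \<in> borel_measurable M \<Longrightarrow> AE x in M. v x = u (A x) \<Longrightarrow> (u, v) \<in> lim_An"
proof -
  have u: "u \<in> borel_measurable M" using assms unfolding scr_F_tilde_def ae_saturate_def by simp
  obtain k n c L \<tau> where \<tau>: "\<And>i. i < n \<Longrightarrow> \<tau> i \<in> sets (N L)"
    "\<And>i. i < n \<Longrightarrow> \<delta> L -` \<tau> i \<inter> space M \<subseteq> Y k" "\<And>i. i < n \<Longrightarrow> emeasure (N L) (\<tau> i) < \<infinity>"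
    "AE x in M. u x = step_fun n c \<tau> (\<delta> L x)"
    by (rule F_tilde_step_fun[OF assms]) (rule that)
  have fin: "emeasure (distr M M A) (\<delta> L -` \<tau> i \<inter> space M) < \<infinity>" if "i < n" for i
    using emeasure_mono[OF \<tau>(2)[OF that], of "distr M M A"] image_Y_finite[of k]
    by (auto intro: le_less_trans)
  note * = cylinder_step_fun_in_lim[OF \<tau>(1) \<tau>(3) fin u \<tau>(4)]
  have uA: "u \<circ> A \<in> borel_measurable M" using A_measurable u by (rule measurable_comp)
  show "u \<in> L2_space M" by (rule *(1)[OF _ _ _ uA]) auto
  show "u \<circ> A \<in> L2_space M" by (rule *(2)[OF _ _ _ uA]) auto
  show "(u, v) \<in> lim_An" if "v \<in> borel_measurable M" "AE x in M. v x = u (A x)" for v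
    by (rule *(3)[OF _ _ _ that])
qed

lemma F_tilde_subset_Domain: "F_tilde \<subseteq> Domain lim_An"
proof
  fix u assume u: "u \<in> F_tilde"
  then have "(u, u \<circ> A) \<in> lim_An"
    using F_tilde_lim(2)[OF u] by (intro F_tilde_lim(3)) (auto simp: L2_space_iff)
  then show "u \<in> Domain lim_An" by blast
qed

lemma restrict_lim_eq_restrict_comp:
  "op_restrict lim_An F_tilde = op_restrict (comp_op M A) F_tilde"
proof (intro equalityI subsetI)
  fix p assume p: "p \<in> op_restrict lim_An F_tilde"
  then obtain u v where uv: "p = (u, v)" "(u, v) \<in> lim_An" "u \<in> F_tilde"
    unfolding op_restrict_def by auto
  have "(u, u \<circ> A) \<in> lim_An"
    using F_tilde_lim(2)[OF uv(3)] by (intro F_tilde_lim(3)[OF uv(3)]) (auto simp: L2_space_iff)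
  from lim_An_unique[OF uv(2) this] have "AE x in M. v x = (u \<circ> A) x" .
  moreover have "v \<in> L2_space M" using uv(2) unfolding lim_op_def by auto
  ultimately show "p \<in> op_restrict (comp_op M A) F_tilde"
    using uv F_tilde_lim(1,2)[OF uv(3)] unfolding op_restrict_def comp_op_def by auto
next
  fix p assume p: "p \<in> op_restrict (comp_op M A) F_tilde"
  then obtain u v where uv: "p = (u, v)" "(u, v) \<in> comp_op M A" "u \<in> F_tilde"
    unfolding op_restrict_def by auto
  then have "(u, v) \<in> lim_An"
    by (intro F_tilde_lim(3)[OF uv(3)]) (auto simp: comp_op_def L2_space_iff)
  then show "p \<in> op_restrict lim_An F_tilde" using uv unfolding op_restrict_def by auto
qed

section \<open>Density in the graph norm\<close>

lemma step_fun_in_F_tilde: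
  assumes W: "incseq W" "\<And>k. W k \<subseteq> Y k" "\<And>k. W k \<in> sets M" "\<And>k. emeasure M (W k) < \<infinity>"
    and s: "\<forall>i<n. s i \<in> cylinder_sets N M \<delta> \<and> (\<exists>k. s i \<subseteq> W k)"
  shows "step_fun n c s \<in> F_tilde"
proof -
  obtain k where k: "\<And>i. i < n \<Longrightarrow> s i \<subseteq> W (k i)" using s by metis
  define K where "K = (\<Sum>i<n. k i)"
  have sW: "s i \<subseteq> W K" if "i < n" for i
  proof -
    have "k i \<le> K" unfolding K_def using that by (intro member_le_sum) auto
    then show ?thesis using k[OF that] incseqD[OF W(1)] by blast
  qed
  have fin: "emeasure M (s i) < \<infinity>" if "i < n" for i
    using emeasure_mono[OF sW[OF that] W(3)] W(4)[of K] by (rule le_less_trans)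
  have "step_fun n c s \<in> scr_F N M \<delta>" using s fin by (intro step_fun_in_scr_F) auto
  moreover have "step_fun n c s = (\<lambda>x. indicator (Y K) x * step_fun n c s x)"
  proof
    fix x show "step_fun n c s x = indicator (Y K) x * step_fun n c s x"
      using sW W(2)[of K] by (cases "x \<in> Y K") (auto simp: step_fun_def indicator_def intro!: sum.neutral)
  qed
  moreover have "step_fun n c s \<in> borel_measurable M"
    using s cylinder_in_sets by (intro step_fun_measurable) auto
  ultimately show ?thesis unfolding scr_F_tilde_def by (intro ae_saturateI) blast+
qed

lemma comp_op_F_tilde: "u \<in> F_tilde \<Longrightarrow> (u, u \<circ> A) \<in> op_restrict (comp_op M A) F_tilde"
  using F_tilde_lim(1,2) unfolding op_restrict_def comp_op_def by simp

text \<open>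
  Step functions over cylinder sets inside the common exhaustion lie in the domain and are dense.
\<close>

lemma densely_defined_comp_op: "densely_defined M (comp_op M A)"
  unfolding densely_defined_def
proof
  fix f assume f: "f \<in> L2_space M"
  obtain W where W: "\<And>k. W k \<in> cylinder_sets N M \<delta>" "incseq W" "(\<Union>k. W k) = space M"
    "\<And>k. W k \<subseteq> Y k" "\<And>k. emeasure M (W k) < \<infinity>" "\<And>k. emeasure (distr M M A) (W k) < \<infinity>"
    by (rule common_exhaustion) (rule that)
  interpret algebra_exhaustion M "cylinder_sets N M \<delta>" W
    by (intro algebra_exhaustion.intro algebra_exhaustion_axioms.intro cylinder_sets_algebra sets_generated W)
  obtain u where u: "\<And>m. \<exists>n c s. u m = step_fun n c s \<and> (\<forall>i<n. s i \<in> cylinder_sets N M \<delta> \<and> (\<exists>k. s i \<subseteq> W k))"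
    "(\<lambda>m. energy M (\<lambda>x. u m x - f x)) \<longlonglongrightarrow> 0"
    by (rule step_funs_dense[OF f]) (rule that)
  have uF: "u m \<in> F_tilde" for m
    using u(1)[of m] step_fun_in_F_tilde[OF W(2,4) G_sets[OF W(1)] W(5)] by metis
  have "u m \<in> Domain (comp_op M A)" for m
    using comp_op_F_tilde[OF uF[of m]] unfolding op_restrict_def by auto
  moreover have "L2_tendsto M u f"
    using L2_tendsto_iff_energy[of u M f] F_tilde_lim(1)[OF uF] f u(2) by simp
  ultimately show "\<exists>u. (\<forall>n. u n \<in> Domain (comp_op M A)) \<and> L2_tendsto M u f" by blast
qed

text \<open>
  With \<open>R\<close> the sum of \<open>M\<close> and its image measure under \<open>A\<close>, the squared graph norm of \<open>f\<close> is
  the squared norm of \<open>f\<close> in \<open>L\<^sup>2\<close> of \<open>R\<close>. Approximation in the graph norm is therefore the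
  density of step functions in this one space, whose measure is again finite on the common
  exhaustion.
\<close>

lemma comp_op_subset_closure:
  "comp_op M A \<subseteq> op_closure M (op_restrict (comp_op M A) F_tilde)"
proof
  fix p assume "p \<in> comp_op M A"
  then obtain f g where p: "p = (f, g)" and f: "f \<in> L2_space M" and fA: "f \<circ> A \<in> L2_space M"
    and g: "g \<in> L2_space M" and g_eq: "AE x in M. g x = (f \<circ> A) x"
    unfolding comp_op_def by auto
  obtain W where W: "\<And>k. W k \<in> cylinder_sets N M \<delta>" "incseq W" "(\<Union>k. W k) = space M"
    "\<And>k. W k \<subseteq> Y k" "\<And>k. emeasure M (W k) < \<infinity>" "\<And>k. emeasure (distr M M A) (W k) < \<infinity>"
    by (rule common_exhaustion) (rule that)
  interpret sigma_finite_measure M by (rule M_sigma_finite)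
  define h where "h = RN_deriv M (distr M M A)"
  have h[measurable]: "h \<in> borel_measurable M" unfolding h_def by simp
  have dens: "density M h = distr M M A"
    using A_nonsingular unfolding h_def nonsingular_def by (intro density_RN_deriv) auto
  (* nonsingularity makes the sum of the two measures a density measure over M *)
  define R where "R = density M (\<lambda>x. 1 + h x)"
  have R_int: "(\<integral>\<^sup>+x. q x \<partial>R) = (\<integral>\<^sup>+x. q x \<partial>M) + (\<integral>\<^sup>+x. q x \<partial>distr M M A)"
    if [measurable]: "q \<in> borel_measurable M" for q
  proof -
    have "(\<integral>\<^sup>+x. q x \<partial>R) = (\<integral>\<^sup>+x. q x + h x * q x \<partial>M)"
      unfolding R_def by (simp add: nn_integral_density distrib_right)
    also have "\<dots> = (\<integral>\<^sup>+x. q x \<partial>M) + (\<integral>\<^sup>+x. h x * q x \<partial>M)" by (rule nn_integral_add) auto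
    also have "(\<integral>\<^sup>+x. h x * q x \<partial>M) = (\<integral>\<^sup>+x. q x \<partial>distr M M A)"
      unfolding dens[symmetric] by (simp add: nn_integral_density)
    finally show ?thesis .
  qed
  have R_energy: "energy R q = energy M q + energy M (q \<circ> A)" if [measurable]: "q \<in> borel_measurable M" for q
    using R_int[of "\<lambda>x. ennreal ((cmod (q x))\<^sup>2)"] energy_distr[OF A_measurable that]
    unfolding energy_def by simp
  have spR: "space R = space M" and setsR: "sets R = sets M" unfolding R_def by simp_all
  have WR: "emeasure R (W k) < \<infinity>" for k
    using R_int[of "indicator (W k)"] cylinder_in_sets[OF W(1)[of k]] W(5,6)[of k]
    by (simp add: setsR)
  interpret algebra_exhaustion R "cylinder_sets N M \<delta>" W
    unfolding algebra_exhaustion_def algebra_exhaustion_axioms_def spR setsR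
    using cylinder_sets_algebra sets_generated W WR by auto
  have f_meas[measurable]: "f \<in> borel_measurable M" using f by (simp add: L2_space_iff)
  have "f \<in> L2_space R"
    using f fA R_energy[OF f_meas] unfolding L2_space_iff R_def by simp
  then obtain u where u: "\<And>m. \<exists>n c s. u m = step_fun n c s \<and> (\<forall>i<n. s i \<in> cylinder_sets N M \<delta> \<and> (\<exists>k. s i \<subseteq> W k))"
    "(\<lambda>m. energy R (\<lambda>x. u m x - f x)) \<longlonglongrightarrow> 0"
    by (rule step_funs_dense) (rule that)
  have uF: "u m \<in> F_tilde" for m
    using u(1)[of m] step_fun_in_F_tilde[OF W(2,4) cylinder_in_sets[OF W(1)] W(5)] by metis
  have u_meas[measurable]: "u m \<in> borel_measurable M" for m
    using F_tilde_lim(1)[OF uF] by (simp add: L2_space_iff)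
  have split: "energy R (\<lambda>x. u m x - f x) = energy M (\<lambda>x. u m x - f x) + energy M (\<lambda>x. (u m \<circ> A) x - (f \<circ> A) x)" for m
    using R_energy[of "\<lambda>x. u m x - f x"] by (simp add: comp_def)
  have "(\<lambda>m. energy M (\<lambda>x. u m x - f x)) \<longlonglongrightarrow> 0"
    by (rule tendsto_sandwich[OF _ _ tendsto_const u(2)]) (auto simp: split)
  then have 1: "L2_tendsto M u f"
    using L2_tendsto_iff_energy[of u M f] F_tilde_lim(1)[OF uF] f by simp
  have "(\<lambda>m. energy M (\<lambda>x. (u m \<circ> A) x - (f \<circ> A) x)) \<longlonglongrightarrow> 0"
    by (rule tendsto_sandwich[OF _ _ tendsto_const u(2)]) (auto simp: split)
  then have "L2_tendsto M (\<lambda>m. u m \<circ> A) (f \<circ> A)"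
    using L2_tendsto_iff_energy[of "\<lambda>m. u m \<circ> A" M "f \<circ> A"] F_tilde_lim(2)[OF uF] fA by simp
  moreover have "AE x in M. (f \<circ> A) x = g x" using g_eq by eventually_elim simp
  ultimately have 2: "L2_tendsto M (\<lambda>m. u m \<circ> A) g"
    using L2_tendsto_cong_AE[of "\<lambda>m. u m \<circ> A" "\<lambda>m. u m \<circ> A" M "f \<circ> A" g] F_tilde_lim(2)[OF uF] fA g
    by simp
  show "p \<in> op_closure M (op_restrict (comp_op M A) F_tilde)"
    unfolding p op_closure_def
    using f g 1 2 comp_op_F_tilde[OF uF]
    by (intro CollectI case_prodI conjI exI[of _ u] exI[of _ "\<lambda>m. u m \<circ> A"] allI)
qed

lemma comp_op_eq_closure_lim:
  "comp_op M A = op_closure M (op_restrict lim_An F_tilde)"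
proof -
  have "op_closure M (op_restrict (comp_op M A) F_tilde) \<subseteq> op_closure M (comp_op M A)"
    by (rule op_closure_mono) (auto simp: op_restrict_def)
  also have "\<dots> \<subseteq> comp_op M A"
    using closed_comp_op[OF A_measurable A_nonsingular] unfolding closed_op_def .
  finally show ?thesis
    using comp_op_subset_closure unfolding restrict_lim_eq_restrict_comp by blast
qed

end

section \<open>The limit of composition operators\<close>

theorem theorem4p11:
  fixes N :: "nat \<Rightarrow> 'b measure" and d :: "nat \<Rightarrow> nat \<Rightarrow> 'b \<Rightarrow> 'b"
    and M :: "'a measure" and \<delta> :: "nat \<Rightarrow> 'a \<Rightarrow> 'b"
    and An :: "nat \<Rightarrow> 'b \<Rightarrow> 'b" and A :: "'a \<Rightarrow> 'a"
  assumes "isometric_target_space N d M \<delta>"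
    and "\<And>n. An n \<in> measurable (N n) (N n)"
    and "A \<in> measurable M M"
    and "\<And>k \<sigma>. \<sigma> \<in> sets (N k) \<Longrightarrow>
      (\<lambda>n. emeasure M (sym_diff ((d k n \<circ> An n \<circ> \<delta> n) -` \<sigma> \<inter> space M)
                                ((\<delta> k \<circ> A) -` \<sigma> \<inter> space M))) \<longlonglongrightarrow> 0"
  shows "target_space (\<lambda>n. distr (N n) (N n) (An n)) d (distr M M A) \<delta> \<and>
    (\<forall>Y.
      (\<forall>n. nonsingular (N n) (An n)) \<and>
      (\<forall>n. Y n \<in> cylinder_sets N M \<delta>) \<and> incseq Y \<and> (\<Union>n. Y n) = space M \<and>
      (\<forall>k. (\<forall>n. (\<integral>\<^sup>+ x. indicator (Y k) x * h_deriv (N n) (An n) (\<delta> n x) \<partial>M) < \<infinity>) \<and>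
           scr_M (\<lambda>n. M) (\<lambda>n x. enn2real (indicator (Y k) x * h_deriv (N n) (An n) (\<delta> n x))) \<noteq> {})
      \<longrightarrow>
      nonsingular M A \<and>
      densely_defined M (comp_op M A) \<and>
      closed_op M (comp_op M A) \<and>
      scr_F_tilde N M \<delta> Y \<subseteq> Domain (lim_op N d M \<delta> (\<lambda>n. comp_op (N n) (An n))) \<and>
      comp_op M A =
        op_closure M (op_restrict (lim_op N d M \<delta> (\<lambda>n. comp_op (N n) (An n)))
          (scr_F_tilde N M \<delta> Y)))"
proof (intro conjI allI impI; (elim conjE)?)
  interpret approximated_transformation N d M \<delta> An A
    by (intro approximated_transformation.intro approximated_transformation_axioms.intro assms)
  show "target_space (\<lambda>n. distr (N n) (N n) (An n)) d (distr M M A) \<delta>"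
    by (rule transported_target_space)
  fix Y
  assume "\<forall>n. nonsingular (N n) (An n)" "\<forall>n. Y n \<in> cylinder_sets N M \<delta>" "incseq Y" "(\<Union>n. Y n) = space M"
    "\<forall>k. (\<forall>n. (\<integral>\<^sup>+ x. indicator (Y k) x * h_deriv (N n) (An n) (\<delta> n x) \<partial>M) < \<infinity>) \<and>
       scr_M (\<lambda>n. M) (\<lambda>n x. enn2real (indicator (Y k) x * h_deriv (N n) (An n) (\<delta> n x))) \<noteq> {}"
  then interpret locally_integrable_approximation N d M \<delta> An A Y
    by unfold_locales blast+
  show "nonsingular M A" by (rule A_nonsingular)
  show "densely_defined M (comp_op M A)" by (rule densely_defined_comp_op)
  show "closed_op M (comp_op M A)" by (rule closed_comp_op[OF A_measurable A_nonsingular])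
  show "scr_F_tilde N M \<delta> Y \<subseteq> Domain (lim_op N d M \<delta> (\<lambda>n. comp_op (N n) (An n)))"
    by (rule F_tilde_subset_Domain)
  show "comp_op M A = op_closure M (op_restrict (lim_op N d M \<delta> (\<lambda>n. comp_op (N n) (An n)))
          (scr_F_tilde N M \<delta> Y))"
    by (rule comp_op_eq_closure_lim)
qed

end
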